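(* For every $1\le p<2$ there exists a constant $C_p>0$ such that for every $n\ge1$ and every balanced quantum Boolean function $A\in M_2(\mathbb C)^{\otimes n}$, $$\max_{1\le j\le n}\operatorname{Inf}_j^p(A)\ge C_p\,\frac{\log n}{n}.$$
   Context: $M_2(\mathbb{C})^{\otimes n}\cong M_{2^n}(\mathbb{C})$ with trace $\operatorname{tr}$ and identity $\mathbf 1$. $A\in M_2(\mathbb{C})^{\otimes n}$ is a quantum Boolean function if $A=A^*$ and $A^2=\mathbf 1$; it is balanced if $\operatorname{tr}(A)=0$. Normalized Schatten norm: $\|A\|_p=(2^{-n}\operatorname{tr}|A|^p)^{1/p}$. For $1\le j\le n$, $d_j=\mathbb I^{\otimes(j-1)}\otimes(\mathbb I-\tfrac12\operatorname{tr}(\cdot)\mathbf 1)\otimes\mathbb I^{\otimes(n-j)}$, where $\mathbb I$ is the identity map on $M_2(\mathbb{C})$, and $\operatorname{Inf}_j^p(A)=\|d_jA\|_p^p$. *)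

theory Defs
  imports Complex_Main "Jordan_Normal_Form.Schur_Decomposition"
begin

text \<open>
  The algebra \<open>M\<^sub>2(\<complex>)\<^sup>\<otimes>\<^sup>n\<close> is \<^term>\<open>carrier_mat (2^n) (2^n) :: complex mat set\<close>, identified through
  the Kronecker product below; the first tensor factor is the most significant bit of an index.
\<close>

definition mat_trace :: "complex mat \<Rightarrow> complex" where
  "mat_trace A = (\<Sum>i<dim_row A. A $$ (i, i))"

section \<open>Quantum Boolean functions\<close>

definition quantum_boolean :: "nat \<Rightarrow> complex mat \<Rightarrow> bool" where
  "quantum_boolean n A \<longleftrightarrow>
     A \<in> carrier_mat (2^n) (2^n) \<and> A = mat_adjoint A \<and> A * A = 1\<^sub>m (2^n)"

definition balanced :: "complex mat \<Rightarrow> bool" where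
  "balanced A \<longleftrightarrow> mat_trace A = 0"

section \<open>Functional calculus and normalized Schatten norms\<close>

definition unitary_diagonalization ::
    "nat \<Rightarrow> complex mat \<Rightarrow> (nat \<Rightarrow> real) \<Rightarrow> complex mat \<Rightarrow> bool" where
  "unitary_diagonalization N U d B \<longleftrightarrow>
     U \<in> carrier_mat N N \<and> mat_adjoint U * U = 1\<^sub>m N \<and>
     B = U * mat_diag N (\<lambda>i. complex_of_real (d i)) * mat_adjoint U"

text \<open>
  \<open>f(B)\<close> for a self-adjoint matrix \<open>B\<close>. The result does not depend on the diagonalization,
  see \<open>mat_fun_eq\<close>.
\<close>

definition mat_fun :: "(real \<Rightarrow> real) \<Rightarrow> complex mat \<Rightarrow> complex mat" where
  "mat_fun f B = (THE C. \<exists>U d. unitary_diagonalization (dim_row B) U d B \<and>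
     C = U * mat_diag (dim_row B) (\<lambda>i. complex_of_real (f (d i))) * mat_adjoint U)"

definition mat_abs :: "complex mat \<Rightarrow> complex mat" where
  "mat_abs A = mat_fun sqrt (mat_adjoint A * A)"

text \<open>
  Below, \<open>0 powr p = 0\<close> is the correct value of \<open>0\<^sup>p\<close>, since \<open>p > 0\<close>; the real part only serves
  to pass from \<open>complex\<close> to \<open>real\<close>, the trace being a nonnegative real number.
\<close>

definition schatten_norm :: "nat \<Rightarrow> real \<Rightarrow> complex mat \<Rightarrow> real" where
  "schatten_norm n p A =
     (1 / 2^n * Re (mat_trace (mat_fun (\<lambda>x. x powr p) (mat_abs A)))) powr (1 / p)"

section \<open>Tensor products of matrices and of linear maps\<close>

definition kron :: "complex mat \<Rightarrow> complex mat \<Rightarrow> complex mat" where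
  "kron A B = mat (dim_row A * dim_row B) (dim_col A * dim_col B)
     (\<lambda>(r, s). A $$ (r div dim_row B, s div dim_col B) * B $$ (r mod dim_row B, s mod dim_col B))"

definition matrix_unit :: "nat \<Rightarrow> nat \<Rightarrow> nat \<Rightarrow> complex mat" where
  "matrix_unit N i j = mat N N (\<lambda>(k, l). if k = i \<and> l = j then 1 else 0)"

text \<open>
  \<open>map_tensor a b \<Phi> \<Psi>\<close> is \<open>\<Phi> \<otimes> \<Psi>\<close> for linear maps \<open>\<Phi>\<close> on \<open>M\<^sub>a(\<complex>)\<close> and \<open>\<Psi>\<close> on \<open>M\<^sub>b(\<complex>)\<close>: it sends
  \<open>X = \<Sum> X(ib+k, jb+l) E\<^sub>i\<^sub>j \<otimes> E\<^sub>k\<^sub>l\<close> to \<open>\<Sum> X(ib+k, jb+l) \<Phi>(E\<^sub>i\<^sub>j) \<otimes> \<Psi>(E\<^sub>k\<^sub>l)\<close>.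
\<close>

definition map_tensor ::
    "nat \<Rightarrow> nat \<Rightarrow> (complex mat \<Rightarrow> complex mat) \<Rightarrow> (complex mat \<Rightarrow> complex mat)
      \<Rightarrow> complex mat \<Rightarrow> complex mat" where
  "map_tensor a b \<Phi> \<Psi> X = mat (a * b) (a * b) (\<lambda>(r, s).
     \<Sum>i<a. \<Sum>j<a. \<Sum>k<b. \<Sum>l<b. X $$ (i * b + k, j * b + l) *
       kron (\<Phi> (matrix_unit a i j)) (\<Psi> (matrix_unit b k l)) $$ (r, s))"

section \<open>Influences\<close>

definition qubit_diff :: "complex mat \<Rightarrow> complex mat" where
  "qubit_diff X = X - (1 / 2 * mat_trace X) \<cdot>\<^sub>m 1\<^sub>m 2"

definition d_op :: "nat \<Rightarrow> nat \<Rightarrow> complex mat \<Rightarrow> complex mat" where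
  "d_op n j = map_tensor (2^(j - 1)) (2 * 2^(n - j)) (\<lambda>X. X)
     (map_tensor 2 (2^(n - j)) qubit_diff (\<lambda>X. X))"

definition influence :: "nat \<Rightarrow> real \<Rightarrow> nat \<Rightarrow> complex mat \<Rightarrow> real" where
  "influence n p j A = schatten_norm n p (d_op n j A) powr p"

section \<open>Independence of the diagonalization\<close>

lemma mat_adjoint_carrier: "A \<in> carrier_mat m n \<Longrightarrow> mat_adjoint A \<in> carrier_mat n m"
  unfolding mat_adjoint_def by auto

lemma mat_fun_eq:
  assumes "unitary_diagonalization N U d B"
  shows "mat_fun f B = U * mat_diag N (\<lambda>i. complex_of_real (f (d i))) * mat_adjoint U"
proof -
  have N: "dim_row B = N" using assms by (auto simp: unitary_diagonalization_def)
  have uniq: "V * mat_diag N (\<lambda>i. complex_of_real (f (e i))) * mat_adjoint V =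
      U * mat_diag N (\<lambda>i. complex_of_real (f (d i))) * mat_adjoint U"
    if "unitary_diagonalization N V e B" for V e
  proof -
    define D where "D = mat_diag N (\<lambda>i. complex_of_real (d i))"
    define E where "E = mat_diag N (\<lambda>i. complex_of_real (e i))"
    define D' where "D' = mat_diag N (\<lambda>i. complex_of_real (f (d i)))"
    define E' where "E' = mat_diag N (\<lambda>i. complex_of_real (f (e i)))"
    define Us where "Us = mat_adjoint U"
    define Vs where "Vs = mat_adjoint V"
    have U: "U \<in> carrier_mat N N" "Us \<in> carrier_mat N N" "Us * U = 1\<^sub>m N" "B = U * D * Us"
      using assms mat_adjoint_carrier by (auto simp: unitary_diagonalization_def Us_def D_def)
    have V: "V \<in> carrier_mat N N" "Vs \<in> carrier_mat N N" "Vs * V = 1\<^sub>m N" "B = V * E * Vs"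
      using that mat_adjoint_carrier by (auto simp: unitary_diagonalization_def Vs_def E_def)
    have UU: "U * Us = 1\<^sub>m N" and VV: "V * Vs = 1\<^sub>m N"
      using mat_mult_left_right_inverse U V by blast+
    have DE: "D \<in> carrier_mat N N" "E \<in> carrier_mat N N" "D' \<in> carrier_mat N N" "E' \<in> carrier_mat N N"
      by (auto simp: D_def E_def D'_def E'_def)
    note [simp] = U(1,2) V(1,2) DE
    define W where "W = Vs * U"
    have W: "W \<in> carrier_mat N N" by (simp add: W_def mult_carrier_mat[of _ N N])
    note ass = assoc_mult_mat[of _ N N _ N _ N]
    note mc = mult_carrier_mat[of _ N N _ N]
    have "Vs * (V * E * Vs) * U = Vs * (U * D * Us) * U" using U V by simp
    moreover have "Vs * (V * E * Vs) * U = (Vs * V) * (E * (Vs * U))"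
      by (simp add: ass mc)
    moreover have "Vs * (U * D * Us) * U = Vs * U * D * (Us * U)"
      by (simp add: ass mc)
    ultimately have "E * W = W * D" using U(3) V(3) W DE by (simp add: W_def mc ass)
    then have *: "(E * W) $$ (i, j) = (W * D) $$ (i, j)" for i j by simp
    have "E' * W = W * D'"
    proof (rule eq_matI)
      fix i j assume "i < dim_row (W * D')" "j < dim_col (W * D')"
      then have ij: "i < N" "j < N" using W by (auto simp: D'_def mat_diag_def)
      have "complex_of_real (e i) * W $$ (i, j) = W $$ (i, j) * complex_of_real (d j)"
        using *[of i j] W ij by (simp add: E_def D_def mat_diag_mult_left mat_diag_mult_right)
      then have "W $$ (i, j) = 0 \<or> e i = d j" by auto
      then show "(E' * W) $$ (i, j) = (W * D') $$ (i, j)"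
        using W ij by (auto simp: E'_def D'_def mat_diag_mult_left mat_diag_mult_right)
    qed (use W DE in \<open>simp_all add: carrier_matD[OF DE(3)] carrier_matD[OF DE(4)]\<close>)
    then have "V * (E' * W) * Us = V * (W * D') * Us" by simp
    moreover have "V * (E' * W) * Us = V * E' * Vs * (U * Us)"
      unfolding W_def by (simp add: ass mc)
    moreover have "V * (W * D') * Us = (V * Vs) * (U * D' * Us)"
      unfolding W_def by (simp add: ass mc)
    ultimately have "V * E' * Vs = U * D' * Us" using UU VV
      by (simp add: mc right_mult_one_mat[of _ N N] left_mult_one_mat[of _ N N])
    then show ?thesis by (simp add: E'_def D'_def Us_def Vs_def)
  qed
  show ?thesis unfolding mat_fun_def N
    by (rule the_equality) (use assms uniq in blast)+
qed

section \<open>Action on elementary tensors\<close>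

lemma div_mod_tensor:
  assumes "k < (b::nat)" shows "(i * b + k) div b = i" "(i * b + k) mod b = k"
  using assms by auto

lemma map_tensor_kron:
  assumes A: "A \<in> carrier_mat a a" and B: "B \<in> carrier_mat b b"
    and \<Phi>: "\<And>Y. Y \<in> carrier_mat a a \<Longrightarrow> \<Phi> Y \<in> carrier_mat a a"
    and \<Psi>: "\<And>Y. Y \<in> carrier_mat b b \<Longrightarrow> \<Psi> Y \<in> carrier_mat b b"
    and lin\<Phi>: "\<And>r s. r < a \<Longrightarrow> s < a \<Longrightarrow>
      \<Phi> A $$ (r, s) = (\<Sum>i<a. \<Sum>j<a. A $$ (i, j) * \<Phi> (matrix_unit a i j) $$ (r, s))"
    and lin\<Psi>: "\<And>r s. r < b \<Longrightarrow> s < b \<Longrightarrow>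
      \<Psi> B $$ (r, s) = (\<Sum>i<b. \<Sum>j<b. B $$ (i, j) * \<Psi> (matrix_unit b i j) $$ (r, s))"
  shows "map_tensor a b \<Phi> \<Psi> (kron A B) = kron (\<Phi> A) (\<Psi> B)"
proof (rule eq_matI)
  have dim\<Phi>: "dim_row (\<Phi> Y) = a" "dim_col (\<Phi> Y) = a" if "Y \<in> carrier_mat a a" for Y
    using \<Phi>[OF that] by auto
  have dim\<Psi>: "dim_row (\<Psi> Y) = b" "dim_col (\<Psi> Y) = b" if "Y \<in> carrier_mat b b" for Y
    using \<Psi>[OF that] by auto
  have unit: "matrix_unit N i j \<in> carrier_mat N N" for N i j by (simp add: matrix_unit_def)
  note dims = dim\<Phi>[OF A] dim\<Psi>[OF B] dim\<Phi>[OF unit] dim\<Psi>[OF unit]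
  fix r s assume "r < dim_row (kron (\<Phi> A) (\<Psi> B))" "s < dim_col (kron (\<Phi> A) (\<Psi> B))"
  then have rs: "r < a * b" "s < a * b" by (auto simp: kron_def dims)
  then have "b > 0" by (cases b) auto
  then have dm: "r div b < a" "s div b < a" "r mod b < b" "s mod b < b"
    using rs by (auto simp: less_mult_imp_div_less)
  have lt: "i * b + k < a * b" if "i < a" "k < b" for i k
  proof -
    have "i * b + k < Suc i * b" using that by simp
    also have "\<dots> \<le> a * b" using that by (intro mult_le_mono1) auto
    finally show ?thesis .
  qed
  have "map_tensor a b \<Phi> \<Psi> (kron A B) $$ (r, s) =
    (\<Sum>i<a. \<Sum>j<a. \<Sum>k<b. \<Sum>l<b. (A $$ (i, j) * B $$ (k, l)) *
      (\<Phi> (matrix_unit a i j) $$ (r div b, s div b) * \<Psi> (matrix_unit b k l) $$ (r mod b, s mod b)))"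
    unfolding map_tensor_def using rs A B
    by (auto simp: kron_def dims lt div_mod_tensor intro!: sum.cong)
  also have "\<dots> = \<Phi> A $$ (r div b, s div b) * \<Psi> B $$ (r mod b, s mod b)"
    unfolding lin\<Phi>[OF dm(1,2)] lin\<Psi>[OF dm(3,4)] sum_distrib_right
    by (simp add: sum_distrib_left mult_ac)
  finally show "map_tensor a b \<Phi> \<Psi> (kron A B) $$ (r, s) = kron (\<Phi> A) (\<Psi> B) $$ (r, s)"
    using rs by (simp add: kron_def dims)
qed (use \<Phi>[OF A] \<Psi>[OF B] in \<open>auto simp: map_tensor_def kron_def\<close>)

lemma sum_matrix_unit:
  assumes "r < N" "s < N"
  shows "(\<Sum>i<N. \<Sum>j<N. A $$ (i, j) * matrix_unit N i j $$ (r, s)) = A $$ (r, s)"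
proof -
  have "(\<Sum>i<N. \<Sum>j<N. A $$ (i, j) * matrix_unit N i j $$ (r, s)) =
    (\<Sum>i<N. if r = i then (\<Sum>j<N. if s = j then A $$ (i, j) else 0) else 0)"
    using assms by (intro sum.cong refl) (auto simp: matrix_unit_def if_distrib[of "times _"] cong: if_cong)
  also have "\<dots> = A $$ (r, s)" using assms by (simp only: sum.delta' finite_lessThan lessThan_iff if_True)
  finally show ?thesis .
qed

lemma map_tensor_linear:
  assumes rs: "r < a * b" "s < a * b"
  shows "map_tensor a b \<Phi> \<Psi> Y $$ (r, s) =
    (\<Sum>i<a * b. \<Sum>j<a * b. Y $$ (i, j) * map_tensor a b \<Phi> \<Psi> (matrix_unit (a * b) i j) $$ (r, s))"
proof -
  let ?G = "\<lambda>i j k l. kron (\<Phi> (matrix_unit a i j)) (\<Psi> (matrix_unit b k l)) $$ (r, s)"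
  let ?S = "{..<a * b} \<times> {..<a * b}"
  have lt: "i * b + k < a * b" if "i < a" "k < b" for i k
  proof -
    have "i * b + k < Suc i * b" using that by simp
    also have "\<dots> \<le> a * b" using that by (intro mult_le_mono1) auto
    finally show ?thesis .
  qed
  have unit: "Y $$ (u, v) = (\<Sum>x\<in>?S. Y $$ x * matrix_unit (a * b) (fst x) (snd x) $$ (u, v))"
    if "u < a * b" "v < a * b" for u v
    using sum_matrix_unit[OF that, of Y] by (simp add: sum.cartesian_product case_prod_unfold)
  have "map_tensor a b \<Phi> \<Psi> Y $$ (r, s) =
    (\<Sum>i<a. \<Sum>j<a. \<Sum>k<b. \<Sum>l<b. Y $$ (i * b + k, j * b + l) * ?G i j k l)"
    using rs by (simp add: map_tensor_def)
  also have "\<dots> = (\<Sum>i<a. \<Sum>j<a. \<Sum>k<b. \<Sum>l<b. \<Sum>x\<in>?S.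
    Y $$ x * (matrix_unit (a * b) (fst x) (snd x) $$ (i * b + k, j * b + l) * ?G i j k l))"
  proof (intro sum.cong refl, goal_cases)
    case (1 i j k l)
    then have "i * b + k < a * b" "j * b + l < a * b" by (auto intro: lt)
    from unit[OF this] show ?case by (simp only: sum_distrib_right mult.assoc)
  qed
  also have "\<dots> = (\<Sum>x\<in>?S. \<Sum>i<a. \<Sum>j<a. \<Sum>k<b. \<Sum>l<b.
    Y $$ x * (matrix_unit (a * b) (fst x) (snd x) $$ (i * b + k, j * b + l) * ?G i j k l))"
    by (simp only: sum.swap[of _ ?S "{..<a}"] sum.swap[of _ ?S "{..<b}"])
  also have "\<dots> = (\<Sum>x\<in>?S. Y $$ x * map_tensor a b \<Phi> \<Psi> (matrix_unit (a * b) (fst x) (snd x)) $$ (r, s))"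
    using rs by (simp add: map_tensor_def sum_distrib_left)
  also have "\<dots> = (\<Sum>i<a * b. \<Sum>j<a * b. Y $$ (i, j) *
    map_tensor a b \<Phi> \<Psi> (matrix_unit (a * b) i j) $$ (r, s))"
    by (simp add: sum.cartesian_product case_prod_unfold)
  finally show ?thesis .
qed

lemma kron_carrier:
  "A \<in> carrier_mat a a' \<Longrightarrow> B \<in> carrier_mat b b' \<Longrightarrow> kron A B \<in> carrier_mat (a * b) (a' * b')"
  by (auto simp: kron_def)

lemma map_tensor_carrier: "map_tensor a b \<Phi> \<Psi> Y \<in> carrier_mat (a * b) (a * b)"
  by (simp add: map_tensor_def)

lemma d_op_kron:
  assumes A: "A \<in> carrier_mat (2^(j - 1)) (2^(j - 1))" and X: "X \<in> carrier_mat 2 2"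
    and B: "B \<in> carrier_mat (2^(n - j)) (2^(n - j))"
  shows "d_op n j (kron A (kron X B)) = kron A (kron (X - (1 / 2 * mat_trace X) \<cdot>\<^sub>m 1\<^sub>m 2) B)"
proof -
  have unit: "matrix_unit N k l \<in> carrier_mat N N" for N k l by (simp add: matrix_unit_def)
  have diff: "qubit_diff Y \<in> carrier_mat 2 2" if "Y \<in> carrier_mat 2 2" for Y
    unfolding qubit_diff_def using that by (intro minus_carrier_mat) simp
  have diff_lin: "qubit_diff X $$ (r, s) =
      (\<Sum>k<2. \<Sum>l<2. X $$ (k, l) * qubit_diff (matrix_unit 2 k l) $$ (r, s))"
    if "r < 2" "s < 2" for r s
  proof -
    have sum2: "(\<Sum>k<2. g k) = g 0 + g 1" for g :: "nat \<Rightarrow> complex"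
      by (simp add: numeral_2_eq_2)
    have entry: "qubit_diff Y $$ (r, s) = Y $$ (r, s) - (if r = s then (Y $$ (0, 0) + Y $$ (1, 1)) / 2 else 0)"
      if "Y \<in> carrier_mat 2 2" for Y
      using that \<open>r < 2\<close> \<open>s < 2\<close> by (simp add: qubit_diff_def mat_trace_def sum2)
    have "r = 0 \<or> r = 1" "s = 0 \<or> s = 1" using that by auto
    then show ?thesis
      unfolding entry[OF X] entry[OF unit] sum2
      by (elim disjE) (simp_all add: matrix_unit_def field_simps)
  qed
  have inner: "map_tensor 2 (2^(n - j)) qubit_diff (\<lambda>X. X) (kron X B) = kron (qubit_diff X) B"
    by (rule map_tensor_kron[OF X B diff _ diff_lin]) (simp_all only: sum_matrix_unit)
  have "d_op n j (kron A (kron X B)) = kron A (map_tensor 2 (2^(n - j)) qubit_diff (\<lambda>X. X) (kron X B))"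
    unfolding d_op_def
    by (rule map_tensor_kron[OF A kron_carrier[OF X B] _ map_tensor_carrier _ map_tensor_linear])
      (simp_all only: sum_matrix_unit)
  then show ?thesis by (simp add: inner qubit_diff_def)
qed

end

(*
  Let D_j = d_j A and let T multiply each Pauli coefficient of a word s by 4^-|s|. With the influences at most
  M <= 1, the smoothed energy Y = ||T D_j||_2^2 = tr(D_j W) / 2^n, where W = T T D_j, is superlinearly small:
  in an eigenbasis of D_j the pairing becomes an average of d_i w_i with d_i the eigenvalues of D_j and w_i the
  diagonal entries of W. Since |d_i| <= 2, the average of |d_i|^p is at most M, and the second and fourth moments
  of w are controlled by ||W||_2^2 <= Y and, through hypercontractivity from L^2 to L^4, by ||W||_4^4 <= Y^2,
  a truncation of d yields Y <= 6 M^(1 + delta) with delta > 0, using p < 2. Only Cauchy-Schwarz for the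
  Hilbert-Schmidt inner product is needed, and hypercontractivity follows by induction on the qubits.

  On the other hand the weights |a_s|^2 of the Pauli coefficients of A form a probability distribution on nonzero
  words with mean length L, where L is the sum of all ||D_j||_2^2 and hence at most 2nM, and by Jensen the total
  smoothed energy is at least 16^-L. So 16^(-2nM) <= 6 n M^(1 + delta), and this forces M >= C log n / n.
*)

theory Submission
  imports Defs "HOL-Analysis.L2_Norm" "HOL-Real_Asymp.Real_Asymp" "Jordan_Normal_Form.Spectral_Radius"
begin

section \<open>Pauli expansions of kernels on bit strings\<close>

text \<open>A classical Boolean function f has |d_j f| in {0, 1}, so all its p-influences coincide
  and a small influence means a small support. The eigenvalues of d_j A may be spread over [-2, 2],
  and many tiny eigenvalues can then carry the L^2 mass, with no gain over a linear bound in M. This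
  is the obstacle that p < 2 removes: if the mean of |d|^p is at most M, the part with |d| <= l has
  L^2 mass at most l^(2-p) M, while the part with |d| > l occupies a fraction of at most M l^-p,
  where a fourth moment helps. The noncommutativity is confined to two places. The pairing tr(D W)
  sees only the diagonal of W in an eigenbasis of D, and diagonal entries have no larger second and
  fourth moments than W itself, so the rest of that estimate concerns real sequences. In the
  induction on qubits, the Pauli components of a square contain commutators, and a bound for the
  Hilbert-Schmidt norm of a product suffices for them.\<close>

definition words :: "nat \<Rightarrow> 'a list set" where
  "words n = {xs. length xs = n}"

lemma words_0 [simp]: "words 0 = {[]}"
  by (auto simp: words_def)

lemma words_Suc: "words (Suc n) = (\<lambda>(a, xs). a # xs) ` (UNIV \<times> words n)"
  by (auto simp: words_def length_Suc_conv image_iff)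

lemma finite_words [simp]: "finite (words n :: 'a::finite list set)"
  by (induction n) (simp_all add: words_Suc)

lemma sum_words_Suc:
  "(\<Sum>xs\<in>words (Suc n). g xs) = (\<Sum>a\<in>UNIV. \<Sum>xs\<in>words n. g ((a::'a::finite) # xs))"
  unfolding words_Suc
  by (subst sum.reindex) (auto simp: inj_on_def sum.cartesian_product case_prod_unfold intro!: sum.cong)

lemma Cons_words [simp]: "a # xs \<in> words (Suc n) \<longleftrightarrow> xs \<in> words n"
  by (auto simp: words_def)

lemma UNIV_bool_pair: "(UNIV :: (bool \<times> bool) set) = {(False, False), (False, True), (True, False), (True, True)}"
  by auto

lemma sum_bool_pair:
  "(\<Sum>k\<in>(UNIV :: (bool \<times> bool) set). g k) =
    g (False, False) + g (False, True) + g (True, False) + (g (True, True) :: 'a::comm_monoid_add)"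
  unfolding UNIV_bool_pair by (simp add: add.assoc)

lemma sum_bool: "(\<Sum>b\<in>(UNIV :: bool set). g b) = g False + (g True :: 'a::comm_monoid_add)"
  by (simp add: UNIV_bool)

text \<open>With bit strings as row and column labels, splitting off the first qubit is removing a
  head, and induction on the number of qubits needs no index arithmetic. Only the values on
  \<open>words n\<close> represent a matrix.\<close>

type_synonym kernel = "bool list \<Rightarrow> bool list \<Rightarrow> complex"
type_synonym pauli_word = "(bool \<times> bool) list"

text \<open>The indices \<open>(False, False)\<close>, \<open>(False, True)\<close>, \<open>(True, False)\<close>, \<open>(True, True)\<close> stand for the
  Pauli matrices \<open>\<one>, \<sigma>\<^sub>z, \<sigma>\<^sub>x, \<sigma>\<^sub>y\<close>; \<open>pauli_comp k f\<close> is the coefficient of the \<open>k\<close>-th one in the first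
  tensor factor.\<close>

fun pauli_comp :: "bool \<times> bool \<Rightarrow> kernel \<Rightarrow> kernel" where
  "pauli_comp (False, False) f = (\<lambda>x y. (f (False # x) (False # y) + f (True # x) (True # y)) / 2)"
| "pauli_comp (False, True) f = (\<lambda>x y. (f (False # x) (False # y) - f (True # x) (True # y)) / 2)"
| "pauli_comp (True, False) f = (\<lambda>x y. (f (False # x) (True # y) + f (True # x) (False # y)) / 2)"
| "pauli_comp (True, True) f = (\<lambda>x y. \<i> * (f (False # x) (True # y) - f (True # x) (False # y)) / 2)"

text \<open>This is 2^-n times the trace of f against the Pauli word s, computed one tensor factor
  at a time.\<close>

fun coef :: "pauli_word \<Rightarrow> kernel \<Rightarrow> complex" where
  "coef [] f = f [] []"
| "coef (k # s) f = coef s (pauli_comp k f)"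

definition weight :: "pauli_word \<Rightarrow> nat" where
  "weight s = length (filter (\<lambda>k. k \<noteq> (False, False)) s)"

lemma weight_simps [simp]:
  "weight [] = 0" "weight (k # s) = (if k = (False, False) then weight s else Suc (weight s))"
  by (simp_all add: weight_def)

section \<open>Hermitian kernels and the normalized Hilbert-Schmidt norm\<close>

definition herm :: "nat \<Rightarrow> kernel \<Rightarrow> bool" where
  "herm n f \<longleftrightarrow> (\<forall>x\<in>words n. \<forall>y\<in>words n. f x y = cnj (f y x))"

lemma hermD: "herm n f \<Longrightarrow> x \<in> words n \<Longrightarrow> y \<in> words n \<Longrightarrow> cnj (f x y) = f y x"
  unfolding herm_def by (drule (1) bspec)+ simp

lemma hermI:
  "(\<And>x y. x \<in> words n \<Longrightarrow> y \<in> words n \<Longrightarrow> cnj (f x y) = f y x) \<Longrightarrow> herm n f"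
  by (simp add: herm_def)

definition kinner :: "nat \<Rightarrow> kernel \<Rightarrow> kernel \<Rightarrow> complex" where
  "kinner n f g = (\<Sum>x\<in>words n. \<Sum>y\<in>words n. cnj (f x y) * g x y) / 2 ^ n"

definition knorm :: "nat \<Rightarrow> kernel \<Rightarrow> real" where
  "knorm n f = sqrt ((\<Sum>x\<in>words n. \<Sum>y\<in>words n. (cmod (f x y))\<^sup>2) / 2 ^ n)"

definition kmult :: "nat \<Rightarrow> kernel \<Rightarrow> kernel \<Rightarrow> kernel" where
  "kmult n f g = (\<lambda>x y. \<Sum>z\<in>words n. f x z * g z y)"

lemma knorm_power2: "(knorm n f)\<^sup>2 = (\<Sum>x\<in>words n. \<Sum>y\<in>words n. (cmod (f x y))\<^sup>2) / 2 ^ n"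
  by (simp add: knorm_def sum_nonneg)

lemma knorm_nonneg [simp]: "knorm n f \<ge> 0"
  by (simp add: knorm_def sum_nonneg)

lemma cnj_mult_self: "cnj z * z = (complex_of_real (cmod z))\<^sup>2"
  by (metis complex_norm_square mult.commute of_real_power)

lemma kinner_self: "kinner n f f = complex_of_real ((knorm n f)\<^sup>2)"
  by (simp add: kinner_def knorm_power2 cnj_mult_self)

text \<open>The four Pauli matrices are orthonormal for the normalized trace product;
  \<open>parseval\<close> iterates this.\<close>

lemma kinner_Suc:
  "kinner (Suc n) f g = (\<Sum>k\<in>UNIV. kinner n (pauli_comp k f) (pauli_comp k g))"
proof -
  let ?W = "words n :: bool list set"
  let ?q = "\<lambda>b c x y. cnj (f (b # x) (c # y)) * g (b # x) (c # y)"
  have *: "((?q False False x y + ?q False True x y) + (?q True False x y + ?q True True x y)) / 2 =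
     (\<Sum>k\<in>UNIV. cnj (pauli_comp k f x y) * pauli_comp k g x y)" for x y
    by (simp add: sum_bool_pair field_simps)
  have "kinner (Suc n) f g =
    (\<Sum>x\<in>?W. \<Sum>y\<in>?W. ((?q False False x y + ?q False True x y) + (?q True False x y + ?q True True x y)) / 2) / 2 ^ n"
    unfolding kinner_def sum_words_Suc sum_bool
    by (simp add: sum.distrib sum_divide_distrib[symmetric])
  also have "\<dots> = (\<Sum>k\<in>UNIV. kinner n (pauli_comp k f) (pauli_comp k g))"
    unfolding * by (simp only: kinner_def sum_bool_pair sum.distrib add_divide_distrib)
  finally show ?thesis .
qed

lemma parseval: "kinner n f g = (\<Sum>s\<in>words n. cnj (coef s f) * coef s g)"
proof (induction n arbitrary: f g)
  case 0
  then show ?case by (simp add: kinner_def)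
next
  case (Suc n)
  then show ?case by (simp add: kinner_Suc sum_words_Suc)
qed

lemma parseval_knorm: "(knorm n f)\<^sup>2 = (\<Sum>s\<in>words n. (cmod (coef s f))\<^sup>2)"
proof -
  have "complex_of_real ((knorm n f)\<^sup>2) = complex_of_real (\<Sum>s\<in>words n. (cmod (coef s f))\<^sup>2)"
    unfolding kinner_self[symmetric] parseval by (simp add: cnj_mult_self)
  then show ?thesis by (simp only: of_real_eq_iff)
qed

lemma knorm_Suc: "(knorm (Suc n) f)\<^sup>2 = (\<Sum>k\<in>UNIV. (knorm n (pauli_comp k f))\<^sup>2)"
  by (simp add: parseval_knorm sum_words_Suc)

lemma knorm_eq_L2_set:
  "knorm n f = L2_set (\<lambda>z. cmod (f (fst z) (snd z))) (words n \<times> words n) / sqrt (2 ^ n)"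
  by (simp add: knorm_def L2_set_def sum.cartesian_product case_prod_unfold real_sqrt_divide)

lemma knorm_triangle: "knorm n (\<lambda>x y. f x y + g x y) \<le> knorm n f + knorm n g"
proof -
  let ?S = "words n \<times> words n :: (bool list \<times> bool list) set"
  have "L2_set (\<lambda>z. cmod (f (fst z) (snd z) + g (fst z) (snd z))) ?S
    \<le> L2_set (\<lambda>z. cmod (f (fst z) (snd z)) + cmod (g (fst z) (snd z))) ?S"
    by (intro L2_set_mono norm_triangle_ineq) auto
  also have "\<dots> \<le> L2_set (\<lambda>z. cmod (f (fst z) (snd z))) ?S + L2_set (\<lambda>z. cmod (g (fst z) (snd z))) ?S"
    by (rule L2_set_triangle_ineq)
  finally show ?thesis
    unfolding knorm_eq_L2_set by (simp add: add_divide_distrib[symmetric] divide_right_mono)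
qed

lemma knorm_scale: "knorm n (\<lambda>x y. c * f x y) = cmod c * knorm n f"
proof -
  have "(\<Sum>x\<in>words n. \<Sum>y\<in>words n. (cmod (c * f x y))\<^sup>2) =
      (cmod c)\<^sup>2 * (\<Sum>x\<in>words n. \<Sum>y\<in>words n. (cmod (f x y))\<^sup>2)"
    by (simp add: norm_mult power_mult_distrib sum_distrib_left)
  then show ?thesis by (simp add: knorm_def real_sqrt_mult real_sqrt_divide)
qed

text \<open>By cyclicity of the trace, the squared Hilbert-Schmidt norm of fg is the trace of f^2
  g^2 for Hermitian f and g, and Cauchy-Schwarz separates the two squares. This is the substitute
  for Hoelder's inequality.\<close>

lemma herm_kmult_cauchy:
  assumes "herm n f" "herm n g"
  shows "(knorm n (kmult n f g))\<^sup>2 \<le> knorm n (kmult n f f) * knorm n (kmult n g g)"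
proof -
  let ?W = "words n :: bool list set"
  let ?S = "?W \<times> ?W"
  have F: "cnj (f x y) = f y x" "cnj (g x y) = g y x" if "x \<in> ?W" "y \<in> ?W" for x y
    using assms that by (simp_all add: hermD)
  have "complex_of_real (\<Sum>x\<in>?W. \<Sum>y\<in>?W. (cmod (kmult n f g x y))\<^sup>2) =
    (\<Sum>x\<in>?W. \<Sum>y\<in>?W. (\<Sum>z\<in>?W. f x z * g z y) * (\<Sum>w\<in>?W. f w x * g y w))"
    unfolding of_real_sum complex_norm_square kmult_def cnj_sum complex_cnj_mult
    by (intro sum.cong arg_cong2[where f = times]) (simp_all add: F)
  also have "\<dots> = (\<Sum>x\<in>?W. \<Sum>y\<in>?W. \<Sum>z\<in>?W. \<Sum>w\<in>?W. f w x * f x z * (g z y * g y w))"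
    unfolding sum_product by (simp only: mult_ac)
  also have "\<dots> = (\<Sum>z\<in>?W. \<Sum>w\<in>?W. \<Sum>x\<in>?W. \<Sum>y\<in>?W. f w x * f x z * (g z y * g y w))"
  proof -
    have "(\<Sum>x\<in>?W. \<Sum>y\<in>?W. \<Sum>z\<in>?W. \<Sum>w\<in>?W. f w x * f x z * (g z y * g y w)) =
      (\<Sum>(x, y)\<in>?S. \<Sum>(z, w)\<in>?S. f w x * f x z * (g z y * g y w))"
      unfolding sum.cartesian_product[symmetric] ..
    also have "\<dots> = (\<Sum>(z, w)\<in>?S. \<Sum>(x, y)\<in>?S. f w x * f x z * (g z y * g y w))"
      unfolding case_prod_unfold by (rule sum.swap)
    finally show ?thesis unfolding sum.cartesian_product[symmetric] .
  qed
  also have "\<dots> = (\<Sum>z\<in>?W. \<Sum>w\<in>?W. kmult n f f w z * kmult n g g z w)"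
    by (simp add: kmult_def sum_product)
  finally have eq: "complex_of_real (\<Sum>x\<in>?W. \<Sum>y\<in>?W. (cmod (kmult n f g x y))\<^sup>2) =
    (\<Sum>z\<in>?W. \<Sum>w\<in>?W. kmult n f f w z * kmult n g g z w)" .
  have "(\<Sum>x\<in>?W. \<Sum>y\<in>?W. (cmod (kmult n f g x y))\<^sup>2) =
      cmod (complex_of_real (\<Sum>x\<in>?W. \<Sum>y\<in>?W. (cmod (kmult n f g x y))\<^sup>2))"
    by (subst norm_of_real) (simp add: sum_nonneg)
  also have "\<dots> = cmod (\<Sum>z\<in>?W. \<Sum>w\<in>?W. kmult n f f w z * kmult n g g z w)"
    by (simp only: eq)
  also have "\<dots> \<le> (\<Sum>z\<in>?W. \<Sum>w\<in>?W. cmod (kmult n f f w z) * cmod (kmult n g g z w))"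
    by (intro order_trans[OF norm_sum] sum_mono) (simp add: norm_mult)
  also have "\<dots> = (\<Sum>z\<in>?S. \<bar>cmod (kmult n f f (snd z) (fst z))\<bar> * \<bar>cmod (kmult n g g (fst z) (snd z))\<bar>)"
    by (simp add: sum.cartesian_product case_prod_unfold)
  also have "\<dots> \<le> L2_set (\<lambda>z. cmod (kmult n f f (snd z) (fst z))) ?S *
      L2_set (\<lambda>z. cmod (kmult n g g (fst z) (snd z))) ?S"
    by (rule L2_set_mult_ineq)
  also have "L2_set (\<lambda>z. cmod (kmult n f f (snd z) (fst z))) ?S =
      L2_set (\<lambda>z. cmod (kmult n f f (fst z) (snd z))) ?S"
    unfolding L2_set_def
    by (intro arg_cong[where f = sqrt] sum.reindex_bij_witness[of _ prod.swap prod.swap]) auto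
  finally have "(\<Sum>x\<in>?W. \<Sum>y\<in>?W. (cmod (kmult n f g x y))\<^sup>2) / 2 ^ n \<le>
      L2_set (\<lambda>z. cmod (kmult n f f (fst z) (snd z))) ?S *
      L2_set (\<lambda>z. cmod (kmult n g g (fst z) (snd z))) ?S / 2 ^ n"
    by (rule divide_right_mono) simp
  then show ?thesis unfolding knorm_power2 by (simp add: knorm_eq_L2_set)
qed

lemma herm_comp:
  assumes "herm (Suc n) f"
  shows "herm n (pauli_comp k f)"
proof -
  have F: "cnj (f (c # y) (b # x)) = f (b # x) (c # y)" if "x \<in> words n" "y \<in> words n" for b c x y
    using that by (intro hermD[OF assms]) simp_all
  show ?thesis
  proof (rule hermI)
    fix x y :: "bool list" assume xy: "x \<in> words n" "y \<in> words n"
    show "cnj (pauli_comp k f x y) = pauli_comp k f y x"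
      by (cases "(k, f)" rule: pauli_comp.cases) (simp_all add: F xy field_simps)
  qed
qed

text \<open>The table sigma_x sigma_y = i sigma_z and its cyclic shifts, for coefficients that do
  not commute: each nontrivial component is an anticommutator with the identity part a plus i times
  a commutator of the other two.\<close>

lemma pauli_comp_kmult:
  fixes f :: kernel and n :: nat
  defines "a \<equiv> pauli_comp (False, False) f" and "z \<equiv> pauli_comp (False, True) f"
    and "x \<equiv> pauli_comp (True, False) f" and "y \<equiv> pauli_comp (True, True) f"
  shows "pauli_comp (False, False) (kmult (Suc n) f f) =
      (\<lambda>u v. kmult n a a u v + kmult n x x u v + kmult n y y u v + kmult n z z u v)" (is ?A)
    and "pauli_comp (False, True) (kmult (Suc n) f f) =
      (\<lambda>u v. kmult n a z u v + kmult n z a u v + \<i> * (kmult n x y u v - kmult n y x u v))" (is ?Z)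
    and "pauli_comp (True, False) (kmult (Suc n) f f) =
      (\<lambda>u v. kmult n a x u v + kmult n x a u v + \<i> * (kmult n y z u v - kmult n z y u v))" (is ?X)
    and "pauli_comp (True, True) (kmult (Suc n) f f) =
      (\<lambda>u v. kmult n a y u v + kmult n y a u v + \<i> * (kmult n z x u v - kmult n x z u v))" (is ?Y)
proof -
  note defs = a_def x_def y_def z_def kmult_def sum_words_Suc sum_bool pauli_comp.simps
  note sums = sum.distrib[symmetric] sum_subtractf[symmetric] sum_distrib_left sum_divide_distrib
  show ?A unfolding defs sums by (intro ext sum.cong refl) (simp add: field_simps)
  show ?X unfolding defs sums by (intro ext sum.cong refl) (simp add: field_simps)
  show ?Y unfolding defs sums by (intro ext sum.cong refl) (simp add: field_simps)
  show ?Z unfolding defs sums by (intro ext sum.cong refl) (simp add: field_simps)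
qed


section \<open>Hypercontractivity\<close>

text \<open>On Hermitian kernels this is the normalized Schatten 4-norm, because tr(f^4) is the
  squared Hilbert-Schmidt norm of f^2.\<close>

definition k4 :: "nat \<Rightarrow> kernel \<Rightarrow> real" where
  "k4 n f = sqrt (knorm n (kmult n f f))"

lemma k4_nonneg [simp]: "k4 n f \<ge> 0"
  by (simp add: k4_def)

lemma k4_power2: "(k4 n f)\<^sup>2 = knorm n (kmult n f f)"
  by (simp add: k4_def)

lemma knorm_kmult_le: "herm n f \<Longrightarrow> herm n g \<Longrightarrow> knorm n (kmult n f g) \<le> k4 n f * k4 n g"
  using real_sqrt_le_mono[OF herm_kmult_cauchy, of n f g] by (simp add: k4_def real_sqrt_mult)

lemma knorm_diff_le: "knorm n (\<lambda>x y. f x y - g x y) \<le> knorm n f + knorm n g"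
  using knorm_triangle[of n f "\<lambda>x y. (-1) * g x y"] knorm_scale[of n "-1" g] by simp

text \<open>Here a, x, y, z stand for the \<open>k4\<close> norms of the Pauli components of f, and
  the four squares bound the components of f^2. The factor 16 is generous: the last estimate
  compares a^4 + 10 a^2 Y + 9 Y^2 with a^4 + 32 a^2 Y + 256 Y^2.\<close>

lemma hyper_step:
  fixes a x y z :: real
  assumes "a \<ge> 0" "x \<ge> 0" "y \<ge> 0" "z \<ge> 0"
  shows "(a\<^sup>2 + x\<^sup>2 + y\<^sup>2 + z\<^sup>2)\<^sup>2 + (2 * a * z + 2 * x * y)\<^sup>2 + (2 * a * x + 2 * y * z)\<^sup>2 + (2 * a * y + 2 * z * x)\<^sup>2
    \<le> (a\<^sup>2 + 16 * (x\<^sup>2 + y\<^sup>2 + z\<^sup>2))\<^sup>2"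
proof -
  have 1: "(2 * p + 2 * q)\<^sup>2 \<le> 8 * p\<^sup>2 + 8 * q\<^sup>2" for p q :: real
    using zero_le_power2[of "p - q"] by (simp add: power2_eq_square algebra_simps)
  define Y where "Y = x\<^sup>2 + y\<^sup>2 + z\<^sup>2"
  have "(2 * a * z + 2 * x * y)\<^sup>2 + (2 * a * x + 2 * y * z)\<^sup>2 + (2 * a * y + 2 * z * x)\<^sup>2
    \<le> 8 * (a\<^sup>2 * Y) + 8 * (x\<^sup>2 * y\<^sup>2 + y\<^sup>2 * z\<^sup>2 + z\<^sup>2 * x\<^sup>2)"
    using 1[of "a * z" "x * y"] 1[of "a * x" "y * z"] 1[of "a * y" "z * x"]
    by (simp add: Y_def power_mult_distrib algebra_simps)
  also have "\<dots> \<le> 8 * (a\<^sup>2 * Y) + 8 * Y\<^sup>2"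
  proof -
    have "Y\<^sup>2 = x\<^sup>2 * x\<^sup>2 + y\<^sup>2 * y\<^sup>2 + z\<^sup>2 * z\<^sup>2 + 2 * (x\<^sup>2 * y\<^sup>2 + y\<^sup>2 * z\<^sup>2 + z\<^sup>2 * x\<^sup>2)"
      by (simp add: Y_def power2_eq_square algebra_simps)
    moreover have "x\<^sup>2 * x\<^sup>2 \<ge> 0" "y\<^sup>2 * y\<^sup>2 \<ge> 0" "z\<^sup>2 * z\<^sup>2 \<ge> 0"
      "x\<^sup>2 * y\<^sup>2 \<ge> 0" "y\<^sup>2 * z\<^sup>2 \<ge> 0" "z\<^sup>2 * x\<^sup>2 \<ge> 0" by simp_all
    ultimately show ?thesis by (simp only: ring_distribs)
  qed
  finally have "(a\<^sup>2 + x\<^sup>2 + y\<^sup>2 + z\<^sup>2)\<^sup>2 + (2 * a * z + 2 * x * y)\<^sup>2 + (2 * a * x + 2 * y * z)\<^sup>2 + (2 * a * y + 2 * z * x)\<^sup>2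
    \<le> (a\<^sup>2 + Y)\<^sup>2 + (8 * (a\<^sup>2 * Y) + 8 * Y\<^sup>2)"
    by (simp add: Y_def add.assoc)
  also have "\<dots> \<le> (a\<^sup>2 + 16 * Y)\<^sup>2"
  proof -
    have "a\<^sup>2 * Y \<ge> 0" "Y\<^sup>2 \<ge> 0" by (simp_all add: Y_def)
    then show ?thesis by (simp add: power2_sum power_mult_distrib mult.commute[of Y])
  qed
  finally show ?thesis by (simp only: Y_def)
qed

text \<open>This is hypercontractivity of the depolarizing semigroup from \<open>L\<^sup>2\<close> to \<open>L\<^sup>4\<close>, stated for the
  output \<open>f\<close> of the noise operator that damps each nontrivial Pauli letter by \<open>1/4\<close>: the right-hand side is
  the squared \<open>L\<^sup>2\<close> norm of its input.\<close>

lemma hypercontractive: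
  "herm n f \<Longrightarrow> (k4 n f)\<^sup>2 \<le> (\<Sum>s\<in>words n. 16 ^ weight s * (cmod (coef s f))\<^sup>2)"
proof (induction n arbitrary: f)
  case 0
  show ?case unfolding k4_power2 by (simp add: knorm_def kmult_def norm_mult power2_eq_square)
next
  case (Suc n)
  define a z x y where "a = pauli_comp (False, False) f" "z = pauli_comp (False, True) f"
    "x = pauli_comp (True, False) f" "y = pauli_comp (True, True) f"
  note defs = this
  let ?H = "\<lambda>f. \<Sum>s\<in>words n. 16 ^ weight s * (cmod (coef s f))\<^sup>2"
  have h: "herm n a" "herm n x" "herm n y" "herm n z"
    unfolding defs using herm_comp[OF Suc.prems] by blast+
  note le = knorm_kmult_le[OF h(1) h(1)] knorm_kmult_le[OF h(2) h(2)]
    knorm_kmult_le[OF h(3) h(3)] knorm_kmult_le[OF h(4) h(4)]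
  \<comment> \<open>No cancellation in the commutators is exploited: each of the four products is
    bounded separately.\<close>
  have mixed: "knorm n (\<lambda>u v. kmult n p q u v + kmult n q p u v + \<i> * (kmult n r s u v - kmult n s r u v))
      \<le> 2 * k4 n p * k4 n q + 2 * k4 n r * k4 n s"
    if "herm n p" "herm n q" "herm n r" "herm n s" for p q r s
  proof -
    have "knorm n (\<lambda>u v. kmult n p q u v + kmult n q p u v + \<i> * (kmult n r s u v - kmult n s r u v))
      \<le> (knorm n (kmult n p q) + knorm n (kmult n q p)) + (knorm n (kmult n r s) + knorm n (kmult n s r))"
      by (rule order_trans[OF knorm_triangle], rule add_mono[OF knorm_triangle])
        (simp add: knorm_scale knorm_diff_le)
    also have "\<dots> \<le> (k4 n p * k4 n q + k4 n q * k4 n p) + (k4 n r * k4 n s + k4 n s * k4 n r)"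
      by (intro add_mono knorm_kmult_le that)
    finally show ?thesis by (simp add: mult_ac)
  qed
  have "(knorm (Suc n) (kmult (Suc n) f f))\<^sup>2 \<le>
      ((k4 n a)\<^sup>2 + (k4 n x)\<^sup>2 + (k4 n y)\<^sup>2 + (k4 n z)\<^sup>2)\<^sup>2 + (2 * k4 n a * k4 n z + 2 * k4 n x * k4 n y)\<^sup>2 +
      (2 * k4 n a * k4 n x + 2 * k4 n y * k4 n z)\<^sup>2 + (2 * k4 n a * k4 n y + 2 * k4 n z * k4 n x)\<^sup>2"
    unfolding knorm_Suc sum_bool_pair pauli_comp_kmult defs[symmetric]
  proof (intro add_mono power_mono mixed h knorm_nonneg)
    show "knorm n (\<lambda>u v. kmult n a a u v + kmult n x x u v + kmult n y y u v + kmult n z z u v)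
      \<le> (k4 n a)\<^sup>2 + (k4 n x)\<^sup>2 + (k4 n y)\<^sup>2 + (k4 n z)\<^sup>2"
      unfolding k4_power2 by (intro order_trans[OF knorm_triangle] add_mono order_refl)
  qed
  also have "\<dots> \<le> ((k4 n a)\<^sup>2 + 16 * ((k4 n x)\<^sup>2 + (k4 n y)\<^sup>2 + (k4 n z)\<^sup>2))\<^sup>2"
    by (intro hyper_step) simp_all
  \<comment> \<open>A nontrivial first letter raises \<open>weight\<close> by one, which is the
    factor 16 in front of the last three components.\<close>
  also have "\<dots> \<le> (?H a + 16 * (?H x + ?H y + ?H z))\<^sup>2"
    by (intro power_mono add_mono mult_left_mono Suc.IH h) simp_all
  also have "?H a + 16 * (?H x + ?H y + ?H z) = (\<Sum>s\<in>words (Suc n). 16 ^ weight s * (cmod (coef s f))\<^sup>2)"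
    by (simp add: sum_words_Suc sum_bool_pair defs sum_distrib_left algebra_simps)
  finally show ?case
    unfolding k4_power2 by (rule power2_le_imp_le) (simp add: sum_nonneg)
qed

section \<open>Influences in the Pauli expansion\<close>

text \<open>This provides the smoothed kernels: the noise operator is not set up as a map, its
  output is built from prescribed coefficients. Real coefficients make the result Hermitian.\<close>

lemma ex_kernel_coef:
  fixes c :: "pauli_word \<Rightarrow> complex"
  assumes "\<And>s. s \<in> words n \<Longrightarrow> c s \<in> \<real>"
  shows "\<exists>f. herm n f \<and> (\<forall>s\<in>words n. coef s f = c s)"
  using assms
proof (induction n arbitrary: c)
  case 0
  then show ?case
    by (intro exI[of _ "\<lambda>x y. c []"]) (auto simp: herm_def Reals_cnj_iff)
next
  case (Suc n)
  have "\<exists>g. herm n g \<and> (\<forall>s\<in>words n. coef s g = c (k # s))" for k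
    using Suc.prems by (intro Suc.IH) simp
  then obtain g where g: "\<And>k. herm n (g k)" "\<And>k s. s \<in> words n \<Longrightarrow> coef s (g k) = c (k # s)"
    by metis
  \<comment> \<open>The block matrix with diagonal blocks a + z, a - z and off-diagonal blocks x -
    iy, x + iy inverts \<open>pauli_comp\<close>.\<close>
  define f :: kernel where "f = (\<lambda>x y.
    if hd x then
      if hd y then g (False, False) (tl x) (tl y) - g (False, True) (tl x) (tl y)
      else g (True, False) (tl x) (tl y) + \<i> * g (True, True) (tl x) (tl y)
    else
      if hd y then g (True, False) (tl x) (tl y) - \<i> * g (True, True) (tl x) (tl y)
      else g (False, False) (tl x) (tl y) + g (False, True) (tl x) (tl y))"
  have "pauli_comp k f = g k" for k
    by (cases "(k, f)" rule: pauli_comp.cases) (auto simp: f_def)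
  moreover have "herm (Suc n) f"
  proof (rule hermI)
    fix x y :: "bool list" assume "x \<in> words (Suc n)" "y \<in> words (Suc n)"
    then have "tl x \<in> words n" "tl y \<in> words n" by (auto simp: words_def)
    then show "cnj (f x y) = f y x" by (simp add: f_def hermD[OF g(1)])
  qed
  ultimately show ?case using g(2) by (intro exI[of _ f]) (auto simp: words_Suc)
qed

lemma coef_real: "herm n f \<Longrightarrow> s \<in> words n \<Longrightarrow> coef s f \<in> \<real>"
proof (induction n arbitrary: f s)
  case 0
  then show ?case using hermD[of 0 f "[]" "[]"] by (simp add: Reals_cnj_iff)
next
  case (Suc n)
  then show ?case by (auto simp: words_Suc herm_comp)
qed

lemma coef_identity_word: "coef (replicate n (False, False)) f = (\<Sum>x\<in>words n. f x x) / 2 ^ n"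
  by (induction n arbitrary: f)
    (simp_all add: sum_words_Suc sum_bool sum.distrib sum_divide_distrib[symmetric])

lemma weight_pos: "s \<in> words n \<Longrightarrow> s \<noteq> replicate n (False, False) \<Longrightarrow> weight s \<ge> 1"
proof (induction n arbitrary: s)
  case (Suc n)
  then obtain k t where s: "s = k # t" "t \<in> words n" by (auto simp: words_Suc)
  show ?case
  proof (cases "k = (False, False)")
    case True
    then show ?thesis using Suc.IH[OF s(2)] Suc.prems(2) by (simp add: s)
  qed (simp add: s)
qed simp

lemma weight_eq_sum: "s \<in> words n \<Longrightarrow> real (weight s) = (\<Sum>j<n. if s ! j = (False, False) then 0 else 1)"
proof (induction n arbitrary: s)
  case (Suc n)
  then show ?case unfolding sum.lessThan_Suc_shift by (auto simp: words_Suc)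
qed simp

text \<open>Qubits are counted from \<open>0\<close> here: on words of length \<open>n > j\<close>, \<open>kdiff j\<close> is \<open>d_op n (j + 1)\<close>. On shorter
  words its values are meaningless (\<open>hd []\<close>).\<close>

primrec kdiff :: "nat \<Rightarrow> kernel \<Rightarrow> kernel" where
  "kdiff 0 f = (\<lambda>x y. f x y - (if hd x = hd y
     then (f (False # tl x) (False # tl y) + f (True # tl x) (True # tl y)) / 2 else 0))"
| "kdiff (Suc j) f = (\<lambda>x y. kdiff j (\<lambda>u v. f (hd x # u) (hd y # v)) (tl x) (tl y))"

lemma kdiff_add: "kdiff j (\<lambda>x y. f x y + g x y) x y = kdiff j f x y + kdiff j g x y"
  by (induction j arbitrary: f g x y) (simp_all add: add_divide_distrib)

lemma kdiff_scale: "kdiff j (\<lambda>x y. c * f x y) x y = c * kdiff j f x y"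
  by (induction j arbitrary: f x y) (simp_all add: algebra_simps)

lemma kdiff_diff: "kdiff j (\<lambda>x y. f x y - g x y) x y = kdiff j f x y - kdiff j g x y"
  using kdiff_add[of j f "\<lambda>x y. (-1) * g x y" x y]
  by (simp add: kdiff_scale[of j "-1", simplified])

lemma kdiff_divide: "kdiff j (\<lambda>x y. f x y / c) x y = kdiff j f x y / c"
  using kdiff_scale[of j "1 / c" f x y] by simp

lemma coef_zero: "coef s (\<lambda>x y. 0) = 0"
proof (induction s)
  case (Cons k s)
  have "pauli_comp k (\<lambda>x y. 0) = (\<lambda>x y. 0)"
    by (cases "(k, \<lambda>(x::bool list) (y::bool list). 0 :: complex)" rule: pauli_comp.cases) simp_all
  then show ?case using Cons by simp
qed simp

lemma coef_kdiff:
  "s \<in> words n \<Longrightarrow> j < n \<Longrightarrow> coef s (kdiff j f) = (if s ! j = (False, False) then 0 else coef s f)"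
proof (induction n arbitrary: s j f)
  case (Suc n)
  then obtain k s' where s: "s = k # s'" "s' \<in> words n" by (auto simp: words_Suc)
  show ?case
  proof (cases j)
    case 0
    have "pauli_comp k (kdiff 0 f) = (if k = (False, False) then (\<lambda>x y. 0) else pauli_comp k f)"
      by (cases "(k, f)" rule: pauli_comp.cases) (auto simp: fun_eq_iff field_simps)
    then show ?thesis by (simp add: s 0 coef_zero)
  next
    case (Suc i)
    have "pauli_comp k (kdiff (Suc i) f) = kdiff i (pauli_comp k f)"
      by (cases "(k, f)" rule: pauli_comp.cases) (auto simp: fun_eq_iff kdiff_add kdiff_diff kdiff_scale kdiff_divide)
    then show ?thesis using Suc.IH[OF s(2), of i] Suc.prems by (simp add: s Suc)
  qed
qed simp

text \<open>Two kernels appear because \<open>kdiff\<close> fixes head bits b and c of row and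
  column: the block (b, c) of a Hermitian kernel is adjoint to the block (c, b), not to itself, so
  an induction on Hermitian kernels would not close.\<close>

lemma cnj_kdiff:
  assumes "\<And>x y. x \<in> words n \<Longrightarrow> y \<in> words n \<Longrightarrow> cnj (f x y) = g y x"
    and "x \<in> words n" "y \<in> words n" "j < n"
  shows "cnj (kdiff j f x y) = kdiff j g y x"
  using assms
proof (induction n arbitrary: j f g x y)
  case (Suc n)
  then obtain b c x' y' where xy: "x = b # x'" "y = c # y'" "x' \<in> words n" "y' \<in> words n"
    by (auto simp: words_Suc)
  show ?case
  proof (cases j)
    case 0
    then show ?thesis using xy by (simp add: Suc.prems(1))
  next
    case (Suc i)
    have "cnj (kdiff i (\<lambda>x y. f (b # x) (c # y)) x' y') = kdiff i (\<lambda>y x. g (c # y) (b # x)) y' x'"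
      using xy Suc.prems(4) Suc by (intro Suc.IH) (simp_all add: Suc.prems(1))
    then show ?thesis by (simp add: Suc xy)
  qed
qed simp

lemma herm_kdiff: "herm n f \<Longrightarrow> j < n \<Longrightarrow> herm n (kdiff j f)"
  by (rule hermI, rule cnj_kdiff[of n]) (simp_all add: hermD)

lemma kdiff_append:
  assumes "length xs = j" "length ys = j"
  shows "kdiff j f (xs @ b # us) (ys @ c # vs) = f (xs @ b # us) (ys @ c # vs) -
    (if b = c then (f (xs @ False # us) (ys @ False # vs) + f (xs @ True # us) (ys @ True # vs)) / 2 else 0)"
  using assms
proof (induction j arbitrary: xs ys f)
  case (Suc j)
  then show ?case by (cases xs; cases ys) simp_all
qed simp

section \<open>Inequalities for real numbers\<close>

lemma avg_cauchy:
  fixes f g :: "nat \<Rightarrow> real"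
  shows "((\<Sum>i<N. f i * g i) / N)\<^sup>2 \<le> ((\<Sum>i<N. (f i)\<^sup>2) / N) * ((\<Sum>i<N. (g i)\<^sup>2) / N)"
proof -
  have "\<bar>\<Sum>i<N. f i * g i\<bar> \<le> (\<Sum>i<N. \<bar>f i\<bar> * \<bar>g i\<bar>)"
    by (rule order_trans[OF sum_abs]) (simp add: abs_mult)
  also have "\<dots> \<le> L2_set f {..<N} * L2_set g {..<N}"
    by (rule L2_set_mult_ineq)
  finally have "\<bar>\<Sum>i<N. f i * g i\<bar>\<^sup>2 \<le> (L2_set f {..<N} * L2_set g {..<N})\<^sup>2"
    by (rule power_mono) simp
  then have "(\<Sum>i<N. f i * g i)\<^sup>2 \<le> (\<Sum>i<N. (f i)\<^sup>2) * (\<Sum>i<N. (g i)\<^sup>2)"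
    by (simp add: L2_set_def power_mult_distrib sum_nonneg)
  then show ?thesis
    by (simp add: power_divide power2_eq_square divide_right_mono)
qed

text \<open>A weak form of the duality between \<open>L\<^sup>4\<close> and \<open>L\<^sup>p\<close>: split \<open>d\<close> at the threshold \<open>M\<^sup>1\<^sup>/\<^sup>2\<^sup>p\<close>, estimating the
  small values in \<open>L\<^sup>2\<close> and the large ones by means of the fourth moment of \<open>w\<close>.\<close>

lemma avg_pairing_bound:
  fixes d w :: "nat \<Rightarrow> real" and N :: nat and p M Y :: real
  defines "\<delta> \<equiv> min (1/4) ((2 - p) / (2 * p))"
  assumes p: "1 \<le> p" "p < 2" and M: "0 < M" "M \<le> 1"
    and d: "\<And>i. i < N \<Longrightarrow> \<bar>d i\<bar> \<le> 2" "(\<Sum>i<N. \<bar>d i\<bar> powr p) / N \<le> M"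
    and Y: "Y = (\<Sum>i<N. d i * w i) / N"
    and w: "(\<Sum>i<N. (w i)\<^sup>2) / N \<le> Y" "(\<Sum>i<N. (w i) ^ 4) / N \<le> Y\<^sup>2"
  shows "Y \<le> 6 * M powr (1 + \<delta>)"
proof -
  \<comment> \<open>With this threshold the large d i are a fraction of at most l^-p M = M^(1/2),
    and the small ones gain l^(2-p) = M^((2-p)/(2p)) in L^2: positive powers of M on both sides. The
    exponent 1/4 in \<delta> is what remains of the 1/2 after two square roots are accounted for in
    \<open>wb\<close> and \<open>lp\<close>.\<close>
  define l where "l = M powr (1 / (2 * p))"
  have l: "l > 0" using M by (simp add: l_def)
  define s where "s i = (if \<bar>d i\<bar> \<le> l then 1 else 0 :: real)" for i
  define b where "b i = 1 - s i" for i
  have ss: "s i * s i = s i" "b i * b i = b i" "s i \<ge> 0" "b i \<ge> 0" for i by (simp_all add: s_def b_def)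
  define E where "E g = (\<Sum>i<N. g i) / N" for g :: "nat \<Rightarrow> real"
  have E_mono: "E f \<le> E g" if "\<And>i. i < N \<Longrightarrow> f i \<le> g i" for f g
    unfolding E_def by (intro divide_right_mono sum_mono) (use that in auto)
  have E_nonneg: "E g \<ge> 0" if "\<And>i. i < N \<Longrightarrow> g i \<ge> 0" for g
    unfolding E_def by (intro divide_nonneg_nonneg sum_nonneg) (use that in auto)
  have E_scale: "E (\<lambda>i. c * g i) = c * E g" for c g
    by (simp add: E_def sum_distrib_left)
  have cs: "(E (\<lambda>i. f i * g i))\<^sup>2 \<le> E (\<lambda>i. (f i)\<^sup>2) * E (\<lambda>i. (g i)\<^sup>2)" for f g
    unfolding E_def by (rule avg_cauchy)
  have dp: "E (\<lambda>i. \<bar>d i\<bar> powr p) \<le> M" using d(2) by (simp add: E_def)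
  have w2: "E (\<lambda>i. (w i)\<^sup>2) \<le> Y" and w4: "E (\<lambda>i. (w i) ^ 4) \<le> Y\<^sup>2" using w by (simp_all add: E_def)
  have Y0: "Y \<ge> 0" using E_nonneg[of "\<lambda>i. (w i)\<^sup>2"] w2 by auto
  have split: "(d i)\<^sup>2 = \<bar>d i\<bar> powr (2 - p) * \<bar>d i\<bar> powr p" for i
    by (cases "d i = 0") (simp_all add: powr_add[symmetric] powr_numeral)
  have sq: "(d i)\<^sup>2 \<le> t powr (2 - p) * \<bar>d i\<bar> powr p" if "\<bar>d i\<bar> \<le> t" for i t
    unfolding split by (intro mult_right_mono powr_mono2) (use that p in auto)
  have small: "E (\<lambda>i. (d i * s i)\<^sup>2) \<le> l powr (2 - p) * M"
  proof -
    have "E (\<lambda>i. (d i * s i)\<^sup>2) \<le> E (\<lambda>i. l powr (2 - p) * \<bar>d i\<bar> powr p)"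
      by (rule E_mono) (use sq in \<open>auto simp: s_def\<close>)
    also have "\<dots> \<le> l powr (2 - p) * M" unfolding E_scale using dp by (intro mult_left_mono) auto
    finally show ?thesis .
  qed
  have d2: "E (\<lambda>i. (d i)\<^sup>2) \<le> 2 * M"
  proof -
    have "E (\<lambda>i. (d i)\<^sup>2) \<le> E (\<lambda>i. 2 powr (2 - p) * \<bar>d i\<bar> powr p)"
      by (rule E_mono) (use sq d(1) in auto)
    also have "\<dots> \<le> 2 powr (2 - p) * M" unfolding E_scale using dp by (intro mult_left_mono) auto
    also have "\<dots> \<le> 2 powr 1 * M" using p M by (intro mult_right_mono powr_mono) auto
    finally show ?thesis by simp
  qed
  have b1: "E b \<le> l powr (- p) * M"
  proof -
    have "E b \<le> E (\<lambda>i. l powr (- p) * \<bar>d i\<bar> powr p)"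
    proof (rule E_mono)
      fix i
      have "1 \<le> l powr (- p) * \<bar>d i\<bar> powr p" if "l < \<bar>d i\<bar>"
      proof -
        have "1 = l powr (- p) * l powr p" using l by (simp add: powr_add[symmetric])
        also have "\<dots> \<le> l powr (- p) * \<bar>d i\<bar> powr p"
          by (intro mult_left_mono powr_mono2) (use that l p in auto)
        finally show ?thesis .
      qed
      then show "b i \<le> l powr (- p) * \<bar>d i\<bar> powr p" by (auto simp: b_def s_def)
    qed
    also have "\<dots> \<le> l powr (- p) * M" unfolding E_scale using dp by (intro mult_left_mono) auto
    finally show ?thesis .
  qed
  \<comment> \<open>Cauchy-Schwarz pairs the fourth moment of w with the measure of the set where d
    is large; b is its indicator.\<close>
  have wb: "E (\<lambda>i. (w i * b i)\<^sup>2) \<le> Y * sqrt (l powr (- p) * M)"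
  proof -
    have "(E (\<lambda>i. (w i)\<^sup>2 * b i))\<^sup>2 \<le> E (\<lambda>i. ((w i)\<^sup>2)\<^sup>2) * E (\<lambda>i. (b i)\<^sup>2)" by (rule cs)
    also have "\<dots> = E (\<lambda>i. (w i) ^ 4) * E b" by (simp add: power2_eq_square[of "b _"] ss)
    also have "\<dots> \<le> Y\<^sup>2 * (l powr (- p) * M)"
      by (intro mult_mono w4 b1 E_nonneg) (simp_all add: ss)
    finally have "E (\<lambda>i. (w i)\<^sup>2 * b i) \<le> sqrt (Y\<^sup>2 * (l powr (- p) * M))" by (rule real_le_rsqrt)
    also have "\<dots> = Y * sqrt (l powr (- p) * M)" using Y0 by (simp add: real_sqrt_mult)
    finally show ?thesis by (simp add: power_mult_distrib power2_eq_square[of "b _"] ss)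
  qed
  define Y1 where "Y1 = E (\<lambda>i. (d i * s i) * w i)"
  define Y2 where "Y2 = E (\<lambda>i. d i * (w i * b i))"
  have "Y = Y1 + Y2"
    unfolding Y Y1_def Y2_def E_def by (simp add: add_divide_distrib[symmetric] sum.distrib[symmetric] b_def algebra_simps)
  have lp: "l powr (2 - p) = M powr ((2 - p) / (2 * p))" "sqrt (l powr (- p) * M) = M powr (1 / 4)"
  proof -
    show "l powr (2 - p) = M powr ((2 - p) / (2 * p))" by (simp add: l_def powr_powr)
    have "l powr (- p) * M = M powr (- (1/2)) * M powr 1" using p M by (simp add: l_def powr_powr)
    also have "\<dots> = M powr (1/2)" by (simp only: powr_add[symmetric]) simp
    finally show "sqrt (l powr (- p) * M) = M powr (1 / 4)"
      by (simp add: powr_half_sqrt[symmetric] powr_powr)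
  qed
  have M\<delta>: "l powr (2 - p) \<le> M powr \<delta>" "sqrt (l powr (- p) * M) \<le> M powr \<delta>"
    unfolding lp \<delta>_def using M by (intro powr_mono'; simp)+
  have "Y1\<^sup>2 \<le> E (\<lambda>i. (d i * s i)\<^sup>2) * E (\<lambda>i. (w i)\<^sup>2)"
    unfolding Y1_def by (rule cs)
  also have "\<dots> \<le> (l powr (2 - p) * M) * Y"
    using M by (intro mult_mono small w2 E_nonneg) auto
  also have "\<dots> \<le> (M powr \<delta> * M) * Y" using M Y0 by (intro mult_right_mono M\<delta>) auto
  finally have Y1: "Y1\<^sup>2 \<le> M powr \<delta> * M * Y" .
  have "Y2\<^sup>2 \<le> E (\<lambda>i. (d i)\<^sup>2) * E (\<lambda>i. (w i * b i)\<^sup>2)"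
    unfolding Y2_def by (rule cs)
  also have "\<dots> \<le> (2 * M) * (Y * sqrt (l powr (- p) * M))"
    using M by (intro mult_mono d2 wb E_nonneg) auto
  also have "\<dots> \<le> (2 * M) * (Y * M powr \<delta>)" using M Y0 by (intro mult_left_mono M\<delta>) auto
  finally have Y2: "Y2\<^sup>2 \<le> 2 * (M powr \<delta> * M * Y)" by (simp add: mult_ac)
  \<comment> \<open>The constant 6 is 2 * 1 + 2 * 2. Both bounds carry a factor Y, because Y itself
    controls the moments of w, and this factor cancels.\<close>
  have "Y\<^sup>2 \<le> 2 * Y1\<^sup>2 + 2 * Y2\<^sup>2"
    unfolding \<open>Y = Y1 + Y2\<close> using zero_le_power2[of "Y1 - Y2"] by (simp add: power2_eq_square algebra_simps)
  then have "Y * Y \<le> 6 * (M powr \<delta> * M) * Y" using Y1 Y2 by (simp add: power2_eq_square)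
  then have "Y \<le> 6 * (M powr \<delta> * M)"
    using Y0 M by (cases "Y = 0") (auto simp: mult_le_cancel_right)
  also have "M powr \<delta> * M = M powr (1 + \<delta>)" using M by (simp add: powr_add mult.commute)
  finally show ?thesis .
qed

text \<open>Jensen's inequality for the convex function 16^-k, by its tangent at the mean L: the
  linear term averages to zero.\<close>

lemma weighted_powr_ge:
  fixes c k :: "'a \<Rightarrow> real"
  assumes "finite S" "\<And>s. s \<in> S \<Longrightarrow> c s \<ge> 0" "(\<Sum>s\<in>S. c s) = 1"
  shows "16 powr (- (\<Sum>s\<in>S. c s * k s)) \<le> (\<Sum>s\<in>S. c s * 16 powr (- k s))"
proof -
  define L where "L = (\<Sum>s\<in>S. c s * k s)"
  have *: "16 powr (- L) * (1 - ln 16 * (k s - L)) \<le> 16 powr (- k s)" for s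
  proof -
    have "16 powr (- k s) = 16 powr (- L) * exp (- (ln 16 * (k s - L)))"
      by (simp add: powr_def exp_add[symmetric] algebra_simps)
    then show ?thesis using exp_ge_add_one_self[of "- (ln 16 * (k s - L))"] by simp
  qed
  have "16 powr (- L) = (\<Sum>s\<in>S. c s * (16 powr (- L) * (1 - ln 16 * (k s - L))))"
  proof -
    have "(\<Sum>s\<in>S. c s * (16 powr (- L) * (1 - ln 16 * (k s - L)))) =
      (\<Sum>s\<in>S. 16 powr (- L) * (1 + ln 16 * L) * c s - 16 powr (- L) * ln 16 * (c s * k s))"
      by (simp add: algebra_simps)
    also have "\<dots> = 16 powr (- L) * (1 + ln 16 * L) - 16 powr (- L) * ln 16 * L"
      by (simp only: sum_subtractf sum_distrib_left[symmetric] assms(3) L_def[symmetric] mult_1_right)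
    also have "\<dots> = 16 powr (- L)" by (simp add: algebra_simps)
    finally show ?thesis ..
  qed
  also have "\<dots> \<le> (\<Sum>s\<in>S. c s * 16 powr (- k s))"
    by (intro sum_mono mult_left_mono * assms)
  finally show ?thesis by (simp add: L_def)
qed

text \<open>If M were below C ln n / n, then 16^(-2nM) would be at least n^(-\<delta>/2), whereas
  the right-hand side would be below 6 n^-\<delta> (ln n)^(1+\<delta>), which is at most
  n^(-\<delta>/2) for large n. For the finitely many other n, the inequality 1 <= 2nM is
  enough.\<close>

lemma log_lower_bound:
  fixes \<delta> :: real
  assumes "\<delta> > 0"
  obtains C :: real where "C > 0"
    "\<And>n M. n \<ge> 1 \<Longrightarrow> 1 \<le> 2 * real n * M \<Longrightarrow>
      (M \<le> 1 \<Longrightarrow> 16 powr (- (2 * real n * M)) \<le> 6 * real n * M powr (1 + \<delta>)) \<Longrightarrow>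
      C * (ln (real n) / real n) \<le> M"
proof -
  have "eventually (\<lambda>n::nat. 6 * ln (real n) powr (1 + \<delta>) \<le> real n powr (\<delta> / 2)) at_top"
    using assms by real_asymp
  then obtain n0 where n0: "\<And>n. n \<ge> n0 \<Longrightarrow> 6 * ln (real n) powr (1 + \<delta>) \<le> real n powr (\<delta> / 2)"
    by (auto simp: eventually_at_top_linorder)
  \<comment> \<open>The three bounds on C serve, in turn, for M < ln n / n <= 1, for the exponent
    \<delta>/2, and for n <= n0. The summand 1 in the last one avoids division by zero at n0 =
    0.\<close>
  define C where "C = min (min 1 (\<delta> / (4 * ln 16))) (1 / (2 * (1 + ln (1 + real n0))))"
  have C: "C > 0" "C \<le> 1" "C \<le> \<delta> / (4 * ln 16)" "C \<le> 1 / (2 * (1 + ln (1 + real n0)))"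
    using assms by (auto simp: C_def add_pos_nonneg)
  have "C * (ln (real n) / real n) \<le> M"
    if n: "n \<ge> 1" and M: "1 \<le> 2 * real n * M"
      and *: "M \<le> 1 \<Longrightarrow> 16 powr (- (2 * real n * M)) \<le> 6 * real n * M powr (1 + \<delta>)" for n M
  proof (cases "n \<le> n0")
    case True
    have "C * ln (real n) \<le> 1 / (2 * (1 + ln (1 + real n0))) * (1 + ln (1 + real n0))"
      using C True n by (intro mult_mono) (auto intro: order_trans[of _ "ln (1 + real n0)"])
    also have "\<dots> = 1 / 2"
    proof -
      have "1 + ln (1 + real n0) > 0" by (simp add: add_pos_nonneg)
      then show ?thesis by simp
    qed
    also have "\<dots> \<le> real n * M" using M by simp
    finally show ?thesis using n by (simp add: field_simps)
  next
    case False
    show ?thesis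
    proof (rule ccontr)
      assume "\<not> ?thesis"
      then have lt: "M < C * (ln (real n) / real n)" by simp
      have M0: "M > 0"
      proof (rule ccontr)
        assume "\<not> M > 0"
        then have "2 * real n * M \<le> 0" by (intro mult_nonneg_nonpos) auto
        then show False using M by linarith
      qed
      have lnn: "ln (real n) > 0" using lt M0 n by (cases "ln (real n) = 0") (auto simp: less_le)
      have lt1: "M < ln (real n) / real n"
        using lt mult_right_mono[OF C(2), of "ln (real n) / real n"] lnn by simp
      have "ln (real n) \<le> real n" using ln_le_minus_one[of "real n"] n by simp
      then have "M \<le> 1" using lt1 n by (intro order_trans[OF less_imp_le[OF lt1]]) simp
      have a: "real n powr (- (\<delta> / 2)) \<le> 16 powr (- (2 * real n * M))"
      proof -
        have "2 * real n * M * ln 16 \<le> 2 * (C * ln (real n)) * ln 16"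
          using lt n by (intro mult_right_mono) (auto simp: field_simps)
        also have "\<dots> = 2 * ln 16 * C * ln (real n)" by simp
        also have "\<dots> \<le> 2 * ln 16 * (\<delta> / (4 * ln 16)) * ln (real n)"
          using C lnn by (intro mult_right_mono mult_left_mono) auto
        also have "\<dots> = \<delta> / 2 * ln (real n)" by simp
        finally show ?thesis using n by (simp add: powr_def)
      qed
      have b: "6 * real n * M powr (1 + \<delta>) < 6 * real n * (ln (real n) / real n) powr (1 + \<delta>)"
        using lt1 M0 assms n by (intro mult_strict_left_mono powr_less_mono2) auto
      have c: "6 * real n * (ln (real n) / real n) powr (1 + \<delta>) = real n powr (- \<delta>) * (6 * ln (real n) powr (1 + \<delta>))"
        using lnn n by (simp add: powr_divide powr_add powr_minus field_simps)
      have "real n powr (- \<delta>) * (6 * ln (real n) powr (1 + \<delta>)) \<le> real n powr (- \<delta>) * real n powr (\<delta> / 2)"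
        using n0[of n] False by (intro mult_left_mono) auto
      also have "\<dots> = real n powr (- (\<delta> / 2))" by (simp only: powr_add[symmetric]) simp
      finally show False using a b c *[OF \<open>M \<le> 1\<close>] by linarith
    qed
  qed
  then show ?thesis using that C(1) by blast
qed

section \<open>Quadratic forms and eigenbases\<close>

definition kapply :: "nat \<Rightarrow> kernel \<Rightarrow> (bool list \<Rightarrow> complex) \<Rightarrow> bool list \<Rightarrow> complex" where
  "kapply n f u x = (\<Sum>y\<in>words n. f x y * u y)"

definition qform :: "nat \<Rightarrow> kernel \<Rightarrow> (bool list \<Rightarrow> complex) \<Rightarrow> complex" where
  "qform n f u = (\<Sum>x\<in>words n. cnj (u x) * kapply n f u x)"

definition vnorm2 :: "nat \<Rightarrow> (bool list \<Rightarrow> complex) \<Rightarrow> real" where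
  "vnorm2 n u = (\<Sum>x\<in>words n. (cmod (u x))\<^sup>2)"

lemma qform_double_sum: "qform n f u = (\<Sum>x\<in>words n. \<Sum>y\<in>words n. cnj (u x) * f x y * u y)"
  by (simp add: qform_def kapply_def sum_distrib_left mult.assoc)

lemma qform_cauchy: "(cmod (qform n f u))\<^sup>2 \<le> vnorm2 n u * vnorm2 n (kapply n f u)"
proof -
  let ?W = "words n :: bool list set"
  have "cmod (qform n f u) \<le> (\<Sum>x\<in>?W. \<bar>cmod (u x)\<bar> * \<bar>cmod (kapply n f u x)\<bar>)"
    unfolding qform_def by (rule order_trans[OF norm_sum]) (simp add: norm_mult)
  also have "\<dots> \<le> L2_set (\<lambda>x. cmod (u x)) ?W * L2_set (\<lambda>x. cmod (kapply n f u x)) ?W"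
    by (rule L2_set_mult_ineq)
  finally have "(cmod (qform n f u))\<^sup>2 \<le> (L2_set (\<lambda>x. cmod (u x)) ?W * L2_set (\<lambda>x. cmod (kapply n f u x)) ?W)\<^sup>2"
    by (rule power_mono) simp
  then show ?thesis by (simp add: L2_set_def power_mult_distrib vnorm2_def sum_nonneg)
qed

lemma qform_kmult_self:
  assumes "herm n f"
  shows "qform n (kmult n f f) u = complex_of_real (vnorm2 n (kapply n f u))"
proof -
  let ?W = "words n :: bool list set"
  have "complex_of_real (vnorm2 n (kapply n f u)) = (\<Sum>z\<in>?W. cnj (kapply n f u z) * kapply n f u z)"
    by (simp add: vnorm2_def cnj_mult_self)
  also have "\<dots> = (\<Sum>z\<in>?W. (\<Sum>x\<in>?W. f x z * cnj (u x)) * (\<Sum>y\<in>?W. f z y * u y))"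
    by (simp add: kapply_def hermD[OF assms])
  also have "\<dots> = (\<Sum>z\<in>?W. \<Sum>x\<in>?W. \<Sum>y\<in>?W. cnj (u x) * (f x z * f z y) * u y)"
    unfolding sum_product by (simp only: mult_ac)
  also have "\<dots> = (\<Sum>x\<in>?W. \<Sum>y\<in>?W. \<Sum>z\<in>?W. cnj (u x) * (f x z * f z y) * u y)"
    by (subst sum.swap, subst (2) sum.swap) (rule refl)
  also have "\<dots> = qform n (kmult n f f) u"
    by (simp add: qform_double_sum kmult_def sum_distrib_left sum_distrib_right)
  finally show ?thesis ..
qed

lemma qform_real:
  assumes "herm n f"
  shows "qform n f u = complex_of_real (Re (qform n f u))"
proof -
  have "cnj (qform n f u) = (\<Sum>x\<in>words n. \<Sum>y\<in>words n. cnj (u y) * f y x * u x)"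
    by (simp add: qform_double_sum hermD[OF assms] mult_ac)
  also have "\<dots> = qform n f u" unfolding qform_double_sum by (rule sum.swap)
  finally show ?thesis by (simp add: complex_eq_iff)
qed

section \<open>Numerical radius under the difference operators\<close>

lemma sum_flip:
  assumes "j < n"
  shows "(\<Sum>x\<in>words n. g (x[j := \<not> x ! j])) = (\<Sum>x\<in>words n. g x)"
  by (rule sum.reindex_bij_witness[of _ "\<lambda>x. x[j := \<not> x ! j]" "\<lambda>x. x[j := \<not> x ! j]"])
    (use assms in \<open>auto simp: words_def\<close>)

lemma kdiff_flip:
  assumes j: "j < n" and x: "x \<in> words n" and y: "y \<in> words n"
  shows "kdiff j f x y = f x y - (if x ! j = y ! j then (f x y + f (x[j := \<not> x ! j]) (y[j := \<not> y ! j])) / 2 else 0)"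
proof -
  have len: "length x = n" "length y = n" using x y by (simp_all add: words_def)
  have x': "x[j := b] = take j x @ b # drop (Suc j) x" "y[j := b] = take j y @ b # drop (Suc j) y" for b
    using len j by (simp_all add: upd_conv_take_nth_drop)
  have "kdiff j f (take j x @ x ! j # drop (Suc j) x) (take j y @ y ! j # drop (Suc j) y) =
     f (x[j := x ! j]) (y[j := y ! j]) -
     (if x ! j = y ! j then (f (x[j := False]) (y[j := False]) + f (x[j := True]) (y[j := True])) / 2 else 0)"
    unfolding x' using len j by (intro kdiff_append) simp_all
  moreover have "take j x @ x ! j # drop (Suc j) x = x" "take j y @ y ! j # drop (Suc j) y = y"
    using len j by (intro id_take_nth_drop[symmetric]; simp)+
  ultimately have "kdiff j f x y = f x y -
     (if x ! j = y ! j then (f (x[j := False]) (y[j := False]) + f (x[j := True]) (y[j := True])) / 2 else 0)"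
    by simp
  moreover have "f (x[j := False]) (y[j := False]) + f (x[j := True]) (y[j := True]) =
      f x y + f (x[j := \<not> x ! j]) (y[j := \<not> y ! j])" if eq: "x ! j = y ! j"
  proof -
    have "x[j := y ! j] = x" "y[j := y ! j] = y" by (subst eq[symmetric], simp) simp
    then show ?thesis unfolding eq by (cases "y ! j") (simp_all add: add.commute)
  qed
  ultimately show ?thesis by simp
qed

text \<open>The conditional expectation is an average of conjugations by the Pauli matrices \<open>\<sigma>\<^sub>z\<close> and \<open>\<sigma>\<^sub>x\<close>
  in the \<open>j\<close>-th factor, which preserve the numerical radius.\<close>

lemma qform_kdiff_le:
  assumes j: "j < n" and f: "\<And>u. cmod (qform n f u) \<le> vnorm2 n u"
  shows "cmod (qform n (kdiff j f) u) \<le> 2 * vnorm2 n u"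
proof -
  let ?W = "words n :: bool list set"
  define fl where "fl x = x[j := \<not> x ! j]" for x :: "bool list"
  \<comment> \<open>\<open>g\<close> is the mean of f and its conjugate by sigma_z; the mean of
    \<open>g\<close> and its conjugate by sigma_x, the flip \<open>fl\<close>, is the conditional
    expectation.\<close>
  define g where "g x y = (if x ! j = y ! j then f x y else 0)" for x y
  have g: "cmod (qform n g v) \<le> vnorm2 n v" for v
  proof -
    define v' where "v' x = (if x ! j then - v x else v x)" for x
    have "2 * qform n g v = qform n f v + qform n f v'"
      unfolding qform_double_sum sum_distrib_left sum.distrib[symmetric]
      by (intro sum.cong refl) (auto simp: g_def v'_def)
    moreover have "vnorm2 n v' = vnorm2 n v"
      unfolding vnorm2_def by (intro sum.cong refl) (auto simp: v'_def)
    ultimately have "cmod (2 * qform n g v) \<le> vnorm2 n v + vnorm2 n v"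
      using f[of v] f[of v'] by (metis add_mono norm_triangle_le)
    then show ?thesis by (simp add: norm_mult)
  qed
  have "2 * qform n (kdiff j f) u = 2 * qform n f u - (qform n g u + qform n g (\<lambda>x. u (fl x)))"
  proof -
    have flip: "qform n g (\<lambda>x. u (fl x)) = (\<Sum>x\<in>?W. \<Sum>y\<in>?W. cnj (u x) * g (fl x) (fl y) * u y)"
      unfolding qform_double_sum
      by (subst (1 2) sum_flip[OF j, symmetric]) (use j in \<open>simp add: fl_def words_def\<close>)
    show ?thesis
      unfolding flip unfolding qform_double_sum sum_distrib_left sum.distrib[symmetric] sum_subtractf[symmetric]
      by (intro sum.cong refl, use j in \<open>auto simp: kdiff_flip[OF j] g_def fl_def words_def algebra_simps\<close>)
  qed
  moreover have "vnorm2 n (\<lambda>x. u (fl x)) = vnorm2 n u"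
    unfolding vnorm2_def fl_def by (rule sum_flip[OF j])
  ultimately have "cmod (2 * qform n (kdiff j f) u) \<le> 2 * vnorm2 n u + (vnorm2 n u + vnorm2 n u)"
    using f[of u] g[of u] g[of "\<lambda>x. u (fl x)"]
      norm_triangle_ineq4[of "2 * qform n f u" "qform n g u + qform n g (\<lambda>x. u (fl x))"]
      norm_triangle_ineq[of "qform n g u" "qform n g (\<lambda>x. u (fl x))"]
    by (simp add: norm_mult)
  then show ?thesis by (simp add: norm_mult)
qed

text \<open>From f^2 = 1 and Hermiticity, f preserves the norm of u, and Cauchy-Schwarz
  applies.\<close>

lemma qform_involution_le:
  assumes h: "herm n f" and sq: "\<And>x y. x \<in> words n \<Longrightarrow> y \<in> words n \<Longrightarrow> kmult n f f x y = (if x = y then 1 else 0)"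
  shows "cmod (qform n f u) \<le> vnorm2 n u"
proof -
  have "complex_of_real (vnorm2 n (kapply n f u)) = (\<Sum>x\<in>words n. \<Sum>y\<in>words n. if x = y then cnj (u x) * u y else 0)"
    unfolding qform_kmult_self[OF h, symmetric] qform_double_sum
    by (intro sum.cong refl) (simp add: sq)
  also have "\<dots> = complex_of_real (vnorm2 n u)" by (simp add: vnorm2_def cnj_mult_self)
  finally have "vnorm2 n (kapply n f u) = vnorm2 n u" by (simp only: of_real_eq_iff)
  with qform_cauchy[of n f u] have "(cmod (qform n f u))\<^sup>2 \<le> (vnorm2 n u)\<^sup>2"
    by (simp add: power2_eq_square)
  then show ?thesis by (rule power2_le_imp_le) (simp add: vnorm2_def sum_nonneg)
qed

section \<open>Diagonal entries in an orthonormal basis\<close>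

lemma sum_vnorm2_kapply_basis:
  fixes u :: "nat \<Rightarrow> bool list \<Rightarrow> complex"
  assumes complete: "\<And>x y. x \<in> words n \<Longrightarrow> y \<in> words n \<Longrightarrow> (\<Sum>i<N. u i x * cnj (u i y)) = (if x = y then 1 else 0)"
  shows "(\<Sum>i<N. vnorm2 n (kapply n f (u i))) = 2 ^ n * (knorm n f)\<^sup>2"
proof -
  let ?W = "words n :: bool list set"
  have "complex_of_real (\<Sum>i<N. vnorm2 n (kapply n f (u i))) =
    (\<Sum>i<N. \<Sum>x\<in>?W. cnj (kapply n f (u i) x) * kapply n f (u i) x)"
    by (simp add: vnorm2_def cnj_mult_self)
  also have "\<dots> = (\<Sum>i<N. \<Sum>x\<in>?W. \<Sum>y\<in>?W. \<Sum>z\<in>?W. cnj (f x y) * f x z * (u i z * cnj (u i y)))"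
    unfolding kapply_def cnj_sum complex_cnj_mult sum_product by (simp only: mult_ac)
  also have "\<dots> = (\<Sum>x\<in>?W. \<Sum>y\<in>?W. \<Sum>z\<in>?W. cnj (f x y) * f x z * (\<Sum>i<N. u i z * cnj (u i y)))"
    unfolding sum_distrib_left
    by (subst sum.swap, subst (2) sum.swap, subst (3) sum.swap) (rule refl)
  also have "\<dots> = (\<Sum>x\<in>?W. \<Sum>y\<in>?W. \<Sum>z\<in>?W. if z = y then cnj (f x y) * f x z else 0)"
    by (intro sum.cong refl) (simp add: complete)
  also have "\<dots> = complex_of_real (2 ^ n * (knorm n f)\<^sup>2)"
    unfolding knorm_power2 by (simp add: cnj_mult_self)
  finally show ?thesis by (simp only: of_real_eq_iff)
qed

text \<open>For a unit vector v, <v, W v>^2 <= |W v|^2 = <v, W^2 v>, and <v, W^2 v>^2 <= |W^2 v|^2.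
  Summing over the basis gives the Hilbert-Schmidt norms of W and of W^2.\<close>

lemma eigenbasis_moments:
  fixes u :: "nat \<Rightarrow> bool list \<Rightarrow> complex" and d :: "nat \<Rightarrow> real"
  assumes complete: "\<And>x y. x \<in> words n \<Longrightarrow> y \<in> words n \<Longrightarrow> (\<Sum>i<2^n. u i x * cnj (u i y)) = (if x = y then 1 else 0)"
    and unit: "\<And>i. i < 2^n \<Longrightarrow> vnorm2 n (u i) = 1"
    and D: "\<And>x y. x \<in> words n \<Longrightarrow> y \<in> words n \<Longrightarrow> D x y = (\<Sum>i<2^n. complex_of_real (d i) * u i x * cnj (u i y))"
    and h: "herm n D" "herm n W"
  defines "w \<equiv> \<lambda>i. Re (qform n W (u i))"
  shows "kinner n D W = complex_of_real ((\<Sum>i<2^n. d i * w i) / 2 ^ n)"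
    and "(\<Sum>i<2^n. (w i)\<^sup>2) / 2 ^ n \<le> (knorm n W)\<^sup>2"
    and "(\<Sum>i<2^n. (w i) ^ 4) / 2 ^ n \<le> (k4 n W) ^ 4"
proof -
  let ?W = "words n :: bool list set"
  have "kinner n D W = (\<Sum>x\<in>?W. \<Sum>y\<in>?W. \<Sum>i<2^n. complex_of_real (d i) * (cnj (u i x) * W x y * u i y)) / 2 ^ n"
    unfolding kinner_def
    by (intro arg_cong2[where f = "(/)"] sum.cong refl) (simp add: D sum_distrib_left mult_ac)
  also have "\<dots> = (\<Sum>i<2^n. complex_of_real (d i) * qform n W (u i)) / 2 ^ n"
    unfolding qform_double_sum sum_distrib_left
    by (subst (2) sum.swap, subst sum.swap, rule refl)
  also have "\<dots> = complex_of_real ((\<Sum>i<2^n. d i * w i) / 2 ^ n)"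
    unfolding w_def by (simp add: qform_real[OF h(2), symmetric])
  finally show "kinner n D W = complex_of_real ((\<Sum>i<2^n. d i * w i) / 2 ^ n)" .
  have basis: "(\<Sum>i<2^n. vnorm2 n (kapply n f (u i))) = 2 ^ n * (knorm n f)\<^sup>2" for f
    by (rule sum_vnorm2_kapply_basis) (rule complete)
  have w2: "(w i)\<^sup>2 \<le> vnorm2 n (kapply n W (u i))" if "i < 2 ^ n" for i
  proof -
    have "(w i)\<^sup>2 \<le> (cmod (qform n W (u i)))\<^sup>2" by (simp add: w_def cmod_power2)
    then show ?thesis using qform_cauchy[of n W "u i"] unit[OF that] by simp
  qed
  have "(\<Sum>i<2^n. (w i)\<^sup>2) \<le> (\<Sum>i<2^n. vnorm2 n (kapply n W (u i)))"
    by (intro sum_mono w2) simp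
  then show "(\<Sum>i<2^n. (w i)\<^sup>2) / 2 ^ n \<le> (knorm n W)\<^sup>2"
    unfolding basis by (simp add: field_simps)
  have w4: "(w i) ^ 4 \<le> vnorm2 n (kapply n (kmult n W W) (u i))" if "i < 2 ^ n" for i
  proof -
    have "((w i)\<^sup>2)\<^sup>2 \<le> (vnorm2 n (kapply n W (u i)))\<^sup>2"
      using w2[OF that] by (intro power_mono) auto
    also have "\<dots> = (cmod (qform n (kmult n W W) (u i)))\<^sup>2"
      unfolding qform_kmult_self[OF h(2)] by simp
    also have "\<dots> \<le> vnorm2 n (kapply n (kmult n W W) (u i))"
      using qform_cauchy[of n "kmult n W W" "u i"] unit[OF that] by simp
    finally show ?thesis by simp
  qed
  have "(\<Sum>i<2^n. (w i) ^ 4) \<le> (\<Sum>i<2^n. vnorm2 n (kapply n (kmult n W W) (u i)))"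
    by (intro sum_mono w4) simp
  then have "(\<Sum>i<2^n. (w i) ^ 4) / 2 ^ n \<le> (knorm n (kmult n W W))\<^sup>2"
    unfolding basis by (simp add: field_simps)
  also have "\<dots> = (k4 n W) ^ 4"
    unfolding k4_power2[symmetric] by (simp add: power_mult[symmetric])
  finally show "(\<Sum>i<2^n. (w i) ^ 4) / 2 ^ n \<le> (k4 n W) ^ 4" .
qed

text \<open>Completeness is recorded because the sums to be contracted run over i; for 2^n unit
  vectors it amounts to orthonormality. The value of \<open>qform\<close> is what links d i to the
  numerical radius.\<close>

definition eigenbasis :: "nat \<Rightarrow> kernel \<Rightarrow> (nat \<Rightarrow> bool list \<Rightarrow> complex) \<Rightarrow> (nat \<Rightarrow> real) \<Rightarrow> bool" where
  "eigenbasis n f u d \<longleftrightarrow>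
    (\<forall>x\<in>words n. \<forall>y\<in>words n. (\<Sum>i<2^n. u i x * cnj (u i y)) = (if x = y then 1 else 0)) \<and>
    (\<forall>i<2^n. vnorm2 n (u i) = 1 \<and> qform n f (u i) = complex_of_real (d i)) \<and>
    (\<forall>x\<in>words n. \<forall>y\<in>words n. f x y = (\<Sum>i<2^n. complex_of_real (d i) * u i x * cnj (u i y)))"

lemma eigenbasis_knorm:
  assumes "eigenbasis n f u d" "herm n f"
  shows "(knorm n f)\<^sup>2 = (\<Sum>i<2^n. (d i)\<^sup>2) / 2 ^ n"
proof -
  have "complex_of_real ((knorm n f)\<^sup>2) = complex_of_real ((\<Sum>i<2^n. d i * Re (qform n f (u i))) / 2 ^ n)"
    unfolding kinner_self[symmetric] using assms
    by (intro eigenbasis_moments(1)) (auto simp: eigenbasis_def)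
  then have "(knorm n f)\<^sup>2 = (\<Sum>i<2^n. d i * Re (qform n f (u i))) / 2 ^ n"
    by (simp only: of_real_eq_iff)
  also have "(\<Sum>i<2^n. d i * Re (qform n f (u i))) = (\<Sum>i<2^n. (d i)\<^sup>2)"
    using assms(1) by (intro sum.cong) (auto simp: eigenbasis_def power2_eq_square)
  finally show ?thesis .
qed

text \<open>The weights of W are 16^-|s|, so that its pairing with f is Y. The cost 16^|s| in
  \<open>hypercontractive\<close> cancels exactly one of the two factors 16^-|s| in the squared
  coefficients of W, and the bound is again Y; this is why the damping rate is 1/4.\<close>

lemma smoothed_energy_le:
  fixes p M :: real
  defines "\<delta> \<equiv> min (1/4) ((2 - p) / (2 * p))"
  assumes p: "1 \<le> p" "p < 2" and M: "0 < M" "M \<le> 1"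
    and f: "herm n f" and ud: "eigenbasis n f u d"
    and d: "\<And>i. i < 2^n \<Longrightarrow> \<bar>d i\<bar> \<le> 2" "(\<Sum>i<2^n. \<bar>d i\<bar> powr p) / 2 ^ n \<le> M"
  shows "(\<Sum>s\<in>words n. (1/16) ^ weight s * (cmod (coef s f))\<^sup>2) \<le> 6 * M powr (1 + \<delta>)"
proof -
  define Y where "Y = (\<Sum>s\<in>words n. (1/16) ^ weight s * (cmod (coef s f))\<^sup>2)"
  have "\<exists>W. herm n W \<and> (\<forall>s\<in>words n. coef s W = complex_of_real ((1/16) ^ weight s) * coef s f)"
    by (intro ex_kernel_coef Reals_mult coef_real[OF f]) simp_all
  then obtain W where W: "herm n W" "\<And>s. s \<in> words n \<Longrightarrow> coef s W = complex_of_real ((1/16) ^ weight s) * coef s f"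
    by blast
  define w where "w i = Re (qform n W (u i))" for i
  note mom = eigenbasis_moments[of n u f d W, OF _ _ _ f W(1), folded w_def]
  have "complex_of_real Y = kinner n f W"
    unfolding parseval Y_def of_real_sum
    by (intro sum.cong refl) (simp add: W(2) complex_norm_square mult_ac del: of_real_power of_real_divide)
  also have "\<dots> = complex_of_real ((\<Sum>i<2^n. d i * w i) / 2 ^ n)"
    using ud by (intro mom) (auto simp: eigenbasis_def)
  finally have Y: "Y = (\<Sum>i<2^n. d i * w i) / real (2 ^ n)" by (simp only: of_real_eq_iff) simp
  have c: "(cmod (coef s W))\<^sup>2 = (1/16) ^ weight s * ((1/16) ^ weight s * (cmod (coef s f))\<^sup>2)" if "s \<in> words n" for s
    by (simp add: W(2)[OF that] norm_mult power_mult_distrib norm_power norm_divide power2_eq_square)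
  have "(\<Sum>i<2^n. (w i)\<^sup>2) / 2 ^ n \<le> (knorm n W)\<^sup>2"
    using ud by (intro mom) (auto simp: eigenbasis_def)
  also have "\<dots> \<le> Y"
    unfolding parseval_knorm Y_def
    by (intro sum_mono) (simp add: c mult_left_le_one_le power_le_one)
  finally have w2: "(\<Sum>i<2^n. (w i)\<^sup>2) / real (2 ^ n) \<le> Y" by simp
  have "(\<Sum>i<2^n. (w i) ^ 4) / 2 ^ n \<le> (k4 n W) ^ 4"
    using ud by (intro mom) (auto simp: eigenbasis_def)
  also have "\<dots> = ((k4 n W)\<^sup>2)\<^sup>2" by simp
  also have "\<dots> \<le> (\<Sum>s\<in>words n. 16 ^ weight s * (cmod (coef s W))\<^sup>2)\<^sup>2"
    by (intro power_mono hypercontractive W) simp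
  also have "(\<Sum>s\<in>words n. 16 ^ weight s * (cmod (coef s W))\<^sup>2) = Y"
    unfolding Y_def by (intro sum.cong refl) (simp add: c power_divide)
  finally have w4: "(\<Sum>i<2^n. (w i) ^ 4) / real (2 ^ n) \<le> Y\<^sup>2" by simp
  show ?thesis
    unfolding Y_def[symmetric] \<delta>_def
    by (rule avg_pairing_bound[OF p M _ _ Y w2 w4]) (use d in auto)
qed

section \<open>Total influence and total smoothed energy\<close>

lemma card_words: "card (words n :: bool list set) = 2 ^ n"
proof (induction n)
  case (Suc n)
  have "inj_on (\<lambda>(a, xs). a # xs) (UNIV \<times> words n :: (bool \<times> bool list) set)"
    by (auto simp: inj_on_def)
  then show ?case by (simp add: words_Suc card_image card_cartesian_product Suc)
qed simp

lemma boolean_kernel_bound: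
  fixes p M :: real
  defines "\<delta> \<equiv> min (1/4) ((2 - p) / (2 * p))"
  assumes p: "1 \<le> p" "p < 2"
    and f: "herm n f" and sq: "\<And>x y. x \<in> words n \<Longrightarrow> y \<in> words n \<Longrightarrow> kmult n f f x y = (if x = y then 1 else 0)"
    and tr: "(\<Sum>x\<in>words n. f x x) = 0"
    and ud: "\<And>j. j < n \<Longrightarrow> eigenbasis n (kdiff j f) (u j) (d j)"
    and M: "\<And>j. j < n \<Longrightarrow> (\<Sum>i<2^n. \<bar>d j i\<bar> powr p) / 2 ^ n \<le> M"
  shows "1 \<le> 2 * real n * M"
    and "M \<le> 1 \<Longrightarrow> 16 powr (- (2 * real n * M)) \<le> 6 * real n * M powr (1 + \<delta>)"
proof -
  let ?W = "words n :: pauli_word set"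
  define c where "c s = (cmod (coef s f))\<^sup>2" for s
  define L where "L = (\<Sum>s\<in>?W. c s * real (weight s))"
  have c0: "c s \<ge> 0" for s by (simp add: c_def)
  have c1: "(\<Sum>s\<in>?W. c s) = 1"
  proof -
    \<comment> \<open>The diagonal of f^2 = 1 says that every row of f is a unit vector.\<close>
    have "complex_of_real (\<Sum>y\<in>words n. (cmod (f x y))\<^sup>2) = 1" if x: "x \<in> words n" for x
    proof -
      have "complex_of_real (\<Sum>y\<in>words n. (cmod (f x y))\<^sup>2) = kmult n f f x x"
        by (simp add: kmult_def complex_norm_square hermD[OF f] x del: of_real_power)
      then show ?thesis by (simp add: sq x)
    qed
    then have "(\<Sum>y\<in>words n. (cmod (f x y))\<^sup>2) = 1" if x: "x \<in> words n" for x
      using x of_real_eq_1_iff by blast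
    then have "(knorm n f)\<^sup>2 = 1" by (simp add: knorm_power2 card_words)
    then show ?thesis by (simp add: parseval_knorm c_def)
  qed
  have d2: "\<bar>d j i\<bar> \<le> 2" if "j < n" "i < 2 ^ n" for j i
  proof -
    have "cmod (qform n (kdiff j f) (u j i)) \<le> 2 * vnorm2 n (u j i)"
      by (intro qform_kdiff_le qform_involution_le f sq that)
    then show ?thesis using ud[OF that(1)] that(2) by (auto simp: eigenbasis_def)
  qed
  \<comment> \<open>Double counting of the pairs (s, j) with a nontrivial letter of s at j. It is
    applied with g = 1 for the mean length and with g s = 16^-|s| for the smoothed energies.\<close>
  have split: "(\<Sum>s\<in>?W. real (weight s) * (c s * g s)) = (\<Sum>j<n. \<Sum>s\<in>?W. g s * (cmod (coef s (kdiff j f)))\<^sup>2)" for g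
  proof -
    have "(\<Sum>s\<in>?W. real (weight s) * (c s * g s)) =
      (\<Sum>s\<in>?W. \<Sum>j<n. g s * (cmod (coef s (kdiff j f)))\<^sup>2)"
    proof (intro sum.cong refl)
      fix s assume s: "s \<in> ?W"
      have "real (weight s) * (c s * g s) = (\<Sum>j<n. (if s ! j = (False, False) then 0 else 1) * (c s * g s))"
        unfolding weight_eq_sum[OF s] by (rule sum_distrib_right)
      also have "\<dots> = (\<Sum>j<n. g s * (cmod (coef s (kdiff j f)))\<^sup>2)"
        by (intro sum.cong refl) (simp add: coef_kdiff[OF s] c_def)
      finally show "real (weight s) * (c s * g s) = (\<Sum>j<n. g s * (cmod (coef s (kdiff j f)))\<^sup>2)" .
    qed
    then show ?thesis by (simp only: sum.swap[of _ ?W])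
  qed
  \<comment> \<open>From |d| <= 2 and 0 < 2 - p <= 1: d^2 = |d|^(2-p) |d|^p <= 2 |d|^p.\<close>
  have kn: "(knorm n (kdiff j f))\<^sup>2 \<le> 2 * M" if j: "j < n" for j
  proof -
    have "(d j i)\<^sup>2 \<le> 2 * \<bar>d j i\<bar> powr p" if "i < 2 ^ n" for i
    proof (cases "d j i = 0")
      case False
      have "(d j i)\<^sup>2 = \<bar>d j i\<bar> powr (2 - p) * \<bar>d j i\<bar> powr p"
        using False by (simp add: powr_add[symmetric] powr_numeral)
      also have "\<dots> \<le> 2 powr (2 - p) * \<bar>d j i\<bar> powr p"
        using d2[OF j that] p by (intro mult_right_mono powr_mono2) auto
      also have "\<dots> \<le> 2 powr 1 * \<bar>d j i\<bar> powr p"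
        using p by (intro mult_right_mono powr_mono) auto
      finally show ?thesis by simp
    qed simp
    then have "(\<Sum>i<2^n. (d j i)\<^sup>2) / 2 ^ n \<le> (\<Sum>i<2^n. 2 * \<bar>d j i\<bar> powr p) / 2 ^ n"
      by (intro divide_right_mono sum_mono) auto
    also have "\<dots> = 2 * ((\<Sum>i<2^n. \<bar>d j i\<bar> powr p) / 2 ^ n)" by (simp add: sum_distrib_left)
    also have "\<dots> \<le> 2 * M" using M[OF j] by simp
    finally show ?thesis unfolding eigenbasis_knorm[OF ud[OF j] herm_kdiff[OF f j]] .
  qed
  have "L = (\<Sum>j<n. (knorm n (kdiff j f))\<^sup>2)"
    using split[of "\<lambda>s. 1"] by (simp add: L_def parseval_knorm mult.commute)
  also have "\<dots> \<le> (\<Sum>j<n. 2 * M)" by (intro sum_mono kn) simp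
  finally have L: "L \<le> 2 * real n * M" by simp
  \<comment> \<open>Balancedness kills the coefficient of the identity word, and every other word
    has weight at least 1.\<close>
  have pos: "c s \<le> c s * real (weight s)" if s: "s \<in> ?W" for s
  proof (cases "s = replicate n (False, False)")
    case True
    then show ?thesis by (simp add: c_def coef_identity_word tr)
  next
    case False
    then show ?thesis using weight_pos[OF s] c0[of s] mult_left_mono[of 1 "real (weight s)" "c s"] by simp
  qed
  have "1 \<le> L" unfolding L_def c1[symmetric] by (intro sum_mono pos)
  with L show one: "1 \<le> 2 * real n * M" by simp
  have M0: "M > 0"
  proof (rule ccontr)
    assume "\<not> M > 0"
    then have "2 * real n * M \<le> 0" by (intro mult_nonneg_nonpos) auto
    then show False using one by linarith
  qed
  assume M1: "M \<le> 1"
  have "16 powr (- (2 * real n * M)) \<le> 16 powr (- L)" using L by simp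
  also have "\<dots> \<le> (\<Sum>s\<in>?W. c s * 16 powr (- real (weight s)))"
    unfolding L_def by (intro weighted_powr_ge c0 c1) simp
  also have "\<dots> = (\<Sum>s\<in>?W. c s * (1/16) ^ weight s)"
    by (intro sum.cong refl) (simp add: powr_minus powr_realpow power_divide inverse_eq_divide)
  \<comment> \<open>Inserting the weight gives the sum the shape that \<open>split\<close>
    distributes over the qubits.\<close>
  also have "\<dots> \<le> (\<Sum>s\<in>?W. c s * real (weight s) * (1/16) ^ weight s)"
    by (intro sum_mono mult_right_mono pos) auto
  also have "\<dots> = (\<Sum>j<n. \<Sum>s\<in>?W. (1/16) ^ weight s * (cmod (coef s (kdiff j f)))\<^sup>2)"
    unfolding split[symmetric] by (simp add: mult_ac)
  also have "\<dots> \<le> (\<Sum>j<n. 6 * M powr (1 + \<delta>))"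
    unfolding \<delta>_def
    by (intro sum_mono smoothed_energy_le[OF p M0 M1]) (use f ud d2 M herm_kdiff in auto)
  finally show "16 powr (- (2 * real n * M)) \<le> 6 * real n * M powr (1 + \<delta>)" by simp
qed

section \<open>The spectral theorem for Hermitian matrices\<close>

lemma index_mat_adjoint [simp]:
  "i < dim_col A \<Longrightarrow> j < dim_row A \<Longrightarrow> mat_adjoint A $$ (i, j) = cnj (A $$ (j, i))"
  for A :: "complex mat"
  by (simp add: mat_adjoint_def mat_of_rows_index)

lemma dim_mat_adjoint [simp]:
  "dim_row (mat_adjoint A) = dim_col A" "dim_col (mat_adjoint A) = dim_row A"
  by (simp_all add: mat_adjoint_def)

lemma mat_adjoint_mult:
  fixes A B :: "complex mat"
  assumes "dim_col A = dim_row B"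
  shows "mat_adjoint (A * B) = mat_adjoint B * mat_adjoint A"
  using assms by (intro eq_matI) (auto simp: scalar_prod_def mult.commute intro!: sum.cong)

lemma unitary_diagonalization_iff:
  assumes B: "B \<in> carrier_mat N N" and U: "U \<in> carrier_mat N N"
  shows "unitary_diagonalization N U d B \<longleftrightarrow>
    (\<forall>i<N. \<forall>j<N. (\<Sum>k<N. cnj (U $$ (k, i)) * U $$ (k, j)) = (if i = j then 1 else 0)) \<and>
    (\<forall>i<N. \<forall>j<N. B $$ (i, j) = (\<Sum>k<N. complex_of_real (d k) * U $$ (i, k) * cnj (U $$ (j, k))))"
proof -
  have "mat_adjoint U * U = 1\<^sub>m N \<longleftrightarrow>
    (\<forall>i<N. \<forall>j<N. (\<Sum>k<N. cnj (U $$ (k, i)) * U $$ (k, j)) = (if i = j then 1 else 0))"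
    using U by (auto simp: mat_eq_iff scalar_prod_def lessThan_atLeast0)
  moreover have "(U * mat_diag N (\<lambda>i. complex_of_real (d i)) * mat_adjoint U) $$ (i, j) =
    (\<Sum>k<N. complex_of_real (d k) * U $$ (i, k) * cnj (U $$ (j, k)))" if "i < N" "j < N" for i j
    using U that by (simp add: mat_diag_mult_right[of _ N] scalar_prod_def lessThan_atLeast0 mult_ac)
  then have "B = U * mat_diag N (\<lambda>i. complex_of_real (d i)) * mat_adjoint U \<longleftrightarrow>
    (\<forall>i<N. \<forall>j<N. B $$ (i, j) = (\<Sum>k<N. complex_of_real (d k) * U $$ (i, k) * cnj (U $$ (j, k))))"
    using U B by (auto simp: mat_eq_iff)
  ultimately show ?thesis using U by (simp add: unitary_diagonalization_def)
qed

lemma unitary_diagonalization_conjugate: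
  assumes V: "V \<in> carrier_mat N N" "mat_adjoint V = V" "V * V = 1\<^sub>m N"
    and A: "A \<in> carrier_mat N N" and d: "unitary_diagonalization N U d (V * A * V)"
  shows "unitary_diagonalization N (V * U) d A"
proof -
  define D where "D = mat_diag N (\<lambda>i. complex_of_real (d i))"
  define Us where "Us = mat_adjoint U"
  have U: "U \<in> carrier_mat N N" "Us * U = 1\<^sub>m N" "V * A * V = U * D * Us"
    using d by (auto simp: unitary_diagonalization_def D_def Us_def)
  have c: "Us \<in> carrier_mat N N" "D \<in> carrier_mat N N" using U(1) by (auto simp: Us_def D_def mat_adjoint_carrier)
  note ass = assoc_mult_mat[of _ N N _ N _ N]
  note mc = mult_carrier_mat[of _ N N _ N]
  have adj: "mat_adjoint (V * U) = Us * V" using V U by (simp add: mat_adjoint_mult Us_def)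
  have "Us * V * (V * U) = Us * (V * V * U)" using V(1) U(1) c by (simp add: ass mc)
  then have 1: "Us * V * (V * U) = 1\<^sub>m N" using V U c by simp
  have "V * (V * A * V) * V = (V * V) * A * (V * V)" using V(1) A by (simp add: ass mc)
  then have "A = V * (V * A * V) * V" using V A by simp
  also have "\<dots> = V * U * D * (Us * V)" unfolding U(3) using V(1) U(1) c by (simp add: ass mc)
  finally show ?thesis
    using V(1) U(1) 1 by (simp add: unitary_diagonalization_def adj D_def)
qed

lemma unitary_diagonalization_block:
  assumes B: "B \<in> carrier_mat (Suc n) (Suc n)" and B': "B' \<in> carrier_mat n n"
    and d: "unitary_diagonalization n U d B'"
    and B00: "B $$ (0, 0) = complex_of_real l"
    and B0: "\<And>i. i < n \<Longrightarrow> B $$ (0, Suc i) = 0" "\<And>i. i < n \<Longrightarrow> B $$ (Suc i, 0) = 0"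
    and BS: "\<And>i j. i < n \<Longrightarrow> j < n \<Longrightarrow> B $$ (Suc i, Suc j) = B' $$ (i, j)"
  shows "\<exists>V e. unitary_diagonalization (Suc n) V e B"
proof -
  have U: "U \<in> carrier_mat n n" using d by (simp add: unitary_diagonalization_def)
  have U1: "(\<Sum>k<n. cnj (U $$ (k, i)) * U $$ (k, j)) = (if i = j then 1 else 0)"
    and U2: "B' $$ (i, j) = (\<Sum>k<n. complex_of_real (d k) * U $$ (i, k) * cnj (U $$ (j, k)))"
    if "i < n" "j < n" for i j
    using d that unfolding unitary_diagonalization_iff[OF B' U] by auto
  \<comment> \<open>The direct sum of the 1 by 1 identity and U, so that the eigenvalue l comes
    first.\<close>
  define V where "V = mat (Suc n) (Suc n) (\<lambda>(i, j). case i of 0 \<Rightarrow> (if j = 0 then 1 else 0)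
    | Suc i' \<Rightarrow> (case j of 0 \<Rightarrow> 0 | Suc j' \<Rightarrow> U $$ (i', j')))"
  have V: "V $$ (0, 0) = 1" "\<And>i. i < n \<Longrightarrow> V $$ (0, Suc i) = 0" "\<And>i. i < n \<Longrightarrow> V $$ (Suc i, 0) = 0"
    "\<And>i j. i < n \<Longrightarrow> j < n \<Longrightarrow> V $$ (Suc i, Suc j) = U $$ (i, j)"
    by (simp_all add: V_def)
  have "unitary_diagonalization (Suc n) V (case_nat l d) B"
  proof (subst unitary_diagonalization_iff[OF B])
    show "V \<in> carrier_mat (Suc n) (Suc n)" by (simp add: V_def)
    have "(\<Sum>k<Suc n. cnj (V $$ (k, i)) * V $$ (k, j)) = (if i = j then 1 else 0)"
      if "i < Suc n" "j < Suc n" for i j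
      unfolding sum.lessThan_Suc_shift using that
      by (cases i; cases j) (simp_all add: V U1)
    moreover have "B $$ (i, j) = (\<Sum>k<Suc n. complex_of_real (case_nat l d k) * V $$ (i, k) * cnj (V $$ (j, k)))"
      if "i < Suc n" "j < Suc n" for i j
      unfolding sum.lessThan_Suc_shift using that
      by (cases i; cases j) (simp_all add: V U2 B00 B0 BS)
    ultimately show "(\<forall>i<Suc n. \<forall>j<Suc n. (\<Sum>k<Suc n. cnj (V $$ (k, i)) * V $$ (k, j)) = (if i = j then 1 else 0)) \<and>
      (\<forall>i<Suc n. \<forall>j<Suc n. B $$ (i, j) = (\<Sum>k<Suc n. complex_of_real (case_nat l d k) * V $$ (i, k) * cnj (V $$ (j, k))))"
      by blast
  qed
  then show ?thesis by blast
qed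

text \<open>The Householder reflection along \<open>e\<^sub>0 - v\<close>. The sign condition keeps \<open>1 - v\<^sub>0\<close> away from \<open>0\<close>.\<close>

lemma householder:
  fixes v :: "complex vec"
  assumes v: "v \<in> carrier_vec (Suc n)" "(\<Sum>i<Suc n. cnj (v $ i) * v $ i) = 1"
    and v0: "v $ 0 = complex_of_real r" "r \<le> 0"
  obtains H where "H \<in> carrier_mat (Suc n) (Suc n)" "mat_adjoint H = H" "H * H = 1\<^sub>m (Suc n)" "col H 0 = v"
proof -
  define w where "w i = (if i = 0 then 1 else 0) - v $ i" for i
  \<comment> \<open>As v is a unit vector, w = e_0 - v has squared norm 2 - 2r = 2c, so 1 - w w^* /
    c is the reflection; w_0 = c makes its first column v.\<close>
  define c where "c = complex_of_real (1 - r)"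
  have c: "c \<noteq> 0" "cnj c = c" using v0 by (simp_all add: c_def del: of_real_diff)
  have w0: "w 0 = c" by (simp add: w_def c_def v0)
  have ww: "(\<Sum>i<Suc n. cnj (w i) * w i) = 2 * c"
  proof -
    have "(\<Sum>i<Suc n. cnj (w i) * w i) = (\<Sum>i<Suc n. cnj (v $ i) * v $ i) + 1 - 2 * complex_of_real r"
      unfolding sum.lessThan_Suc_shift by (simp add: w_def v0 algebra_simps)
    then show ?thesis unfolding v(2) by (simp add: c_def)
  qed
  define H where "H = mat (Suc n) (Suc n) (\<lambda>(i, j). (if i = j then 1 else 0) - w i * cnj (w j) / c)"
  have H: "H \<in> carrier_mat (Suc n) (Suc n)" by (simp add: H_def)
  have "mat_adjoint H = H"
    by (rule eq_matI) (use H in \<open>auto simp: H_def c\<close>)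
  moreover have "H * H = 1\<^sub>m (Suc n)"
  proof (rule eq_matI)
    fix i j assume "i < dim_row (1\<^sub>m (Suc n) :: complex mat)" "j < dim_col (1\<^sub>m (Suc n) :: complex mat)"
    then have ij: "i < Suc n" "j < Suc n" by simp_all
    have "(H * H) $$ (i, j) = (\<Sum>k<Suc n. H $$ (i, k) * H $$ (k, j))"
      using ij H by (simp add: scalar_prod_def lessThan_atLeast0 del: sum.op_ivl_Suc sum.lessThan_Suc)
    also have "\<dots> = (\<Sum>k<Suc n. (if k = i then (if k = j then 1 else 0) - w k * cnj (w j) / c else 0)
        - (if k = j then w i * cnj (w k) / c else 0) + w i * cnj (w j) / (c * c) * (cnj (w k) * w k))"
      using ij c by (intro sum.cong refl) (auto simp: H_def algebra_simps divide_simps)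
    also have "\<dots> = (if i = j then 1 else 0) - w i * cnj (w j) / c - w i * cnj (w j) / c
        + w i * cnj (w j) / (c * c) * (2 * c)"
      unfolding sum.distrib sum_subtractf sum_distrib_left[symmetric] ww
      using ij by (simp only: sum.delta finite_lessThan lessThan_iff if_True)
    also have "\<dots> = 1\<^sub>m (Suc n) $$ (i, j)" using ij c by (simp add: field_simps)
    finally show "(H * H) $$ (i, j) = 1\<^sub>m (Suc n) $$ (i, j)" .
  qed (use H in auto)
  moreover have "col H 0 = v"
    by (rule eq_vecI) (use v w0 c in \<open>auto simp: H_def w_def\<close>)
  ultimately show ?thesis using that H by blast
qed

lemma ex_unit_eigenvector:
  assumes A: "(A :: complex mat) \<in> carrier_mat (Suc n) (Suc n)"
  obtains v k r where "v \<in> carrier_vec (Suc n)" "A *\<^sub>v v = k \<cdot>\<^sub>v v" "(\<Sum>i<Suc n. cnj (v $ i) * v $ i) = 1"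
    "v $ 0 = complex_of_real r" "r \<le> 0"
proof -
  obtain v k where v: "v \<in> carrier_vec (Suc n)" "v \<noteq> 0\<^sub>v (Suc n)" "A *\<^sub>v v = k \<cdot>\<^sub>v v"
    using spectrum_non_empty[OF A] A by (auto simp: spectrum_def eigenvalue_def eigenvector_def)
  define S where "S = (\<Sum>i<Suc n. (cmod (v $ i))\<^sup>2)"
  have S: "S > 0"
  proof -
    from v obtain i where "i < Suc n" "v $ i \<noteq> 0" by (auto simp: vec_eq_iff)
    then show ?thesis unfolding S_def by (intro sum_pos2[of _ i]) auto
  qed
  \<comment> \<open>Normalizes v and rotates its phase so that the first entry becomes nonpositive,
    as \<open>householder\<close> requires. A vanishing first entry needs no rotation.\<close>
  define c where "c = (if v $ 0 = 0 then 1 else - cnj (v $ 0) / complex_of_real (cmod (v $ 0))) / complex_of_real (sqrt S)"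
  have "cmod c = 1 / sqrt S" using S by (simp add: c_def norm_divide)
  then have cc: "cnj c * c = complex_of_real (1 / S)"
    using S by (metis complex_norm_square mult.commute less_imp_le power_divide power_one real_sqrt_pow2)
  have "(\<Sum>i<Suc n. cnj ((c \<cdot>\<^sub>v v) $ i) * (c \<cdot>\<^sub>v v) $ i) = (\<Sum>i<Suc n. complex_of_real (1 / S) * (cnj (v $ i) * v $ i))"
    unfolding cc[symmetric] using v(1) by (intro sum.cong) (auto simp: mult_ac)
  also have "\<dots> = complex_of_real (1 / S) * complex_of_real S"
    unfolding S_def of_real_sum sum_distrib_left complex_norm_square by (simp only: mult.commute)
  also have "\<dots> = 1" using S by (simp del: of_real_divide of_real_mult add: of_real_mult[symmetric])
  finally have 1: "(\<Sum>i<Suc n. cnj ((c \<cdot>\<^sub>v v) $ i) * (c \<cdot>\<^sub>v v) $ i) = 1" .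
  have 2: "(c \<cdot>\<^sub>v v) $ 0 = complex_of_real (- (cmod (v $ 0) / sqrt S))"
  proof (cases "v $ 0 = 0")
    case False
    then have "cnj (v $ 0) * v $ 0 = complex_of_real (cmod (v $ 0)) * complex_of_real (cmod (v $ 0))"
      by (metis complex_norm_square mult.commute of_real_power power2_eq_square)
    then show ?thesis using v(1) False by (simp add: c_def)
  qed (use v(1) in simp)
  have 3: "A *\<^sub>v (c \<cdot>\<^sub>v v) = k \<cdot>\<^sub>v (c \<cdot>\<^sub>v v)"
    using mult_mat_vec[OF A v(1)] v(3) by (simp add: smult_smult_assoc mult.commute)
  show ?thesis by (rule that[OF _ 3 1 2]) (use v(1) S in auto)
qed

text \<open>Deflation: if the reflection H takes e_0 to a unit eigenvector, the first column of H A
  H is a multiple of e_0. Hermitian symmetry clears the first row too, and induction handles the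
  remaining block.\<close>

lemma hermitian_unitary_diagonalization:
  assumes "A \<in> carrier_mat N N" "mat_adjoint A = A"
  shows "\<exists>U d. unitary_diagonalization N U d A"
  using assms
proof (induction N arbitrary: A)
  case 0
  then show ?case
    by (intro exI[of _ "1\<^sub>m 0"] exI) (auto simp: unitary_diagonalization_iff)
next
  case (Suc n)
  note A = Suc.prems
  obtain v k r where v: "v \<in> carrier_vec (Suc n)" "A *\<^sub>v v = k \<cdot>\<^sub>v v"
    "(\<Sum>i<Suc n. cnj (v $ i) * v $ i) = 1" "v $ 0 = complex_of_real r" "r \<le> 0"
    using ex_unit_eigenvector[OF A(1)] by metis
  obtain H where H: "H \<in> carrier_mat (Suc n) (Suc n)" "mat_adjoint H = H" "H * H = 1\<^sub>m (Suc n)" "col H 0 = v"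
    using householder[OF v(1,3,4,5)] by metis
  define B where "B = H * A * H"
  have B: "B \<in> carrier_mat (Suc n) (Suc n)" using H A by (simp add: B_def)
  have "mat_adjoint B = H * (A * H)"
    unfolding B_def using H(1,2) A by (simp add: mat_adjoint_mult)
  also have "\<dots> = B" unfolding B_def using H(1) A(1) by (simp add: assoc_mult_mat[of _ "Suc n" "Suc n" _ "Suc n" _ "Suc n"])
  finally have adjB: "mat_adjoint B = B" .
  have hermB: "cnj (B $$ (i, j)) = B $$ (j, i)" if "i < Suc n" "j < Suc n" for i j
    using arg_cong[OF adjB, of "\<lambda>X. X $$ (j, i)"] B that by simp
  have "col B 0 = H *\<^sub>v (A *\<^sub>v v)"
  proof -
    have "col B 0 = col (H * (A * H)) 0"
      unfolding B_def using H(1) A(1) by (simp add: assoc_mult_mat[of _ "Suc n" "Suc n" _ "Suc n" _ "Suc n"])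
    also have "\<dots> = H *\<^sub>v col (A * H) 0"
      using H(1) A(1) by (intro col_mult2[of _ "Suc n" "Suc n" _ "Suc n"] mult_carrier_mat[of _ _ "Suc n"]) auto
    also have "col (A * H) 0 = A *\<^sub>v v"
      unfolding H(4)[symmetric] using H(1) A(1) by (intro col_mult2[of _ "Suc n" "Suc n" _ "Suc n"]) auto
    finally show ?thesis .
  qed
  also have "\<dots> = k \<cdot>\<^sub>v (H *\<^sub>v v)" unfolding v(2) using H(1) v(1) by (rule mult_mat_vec)
  also have "H *\<^sub>v v = unit_vec (Suc n) 0"
    using col_mult2[of H "Suc n" "Suc n" H "Suc n" 0] H by simp
  finally have colB: "col B 0 = k \<cdot>\<^sub>v unit_vec (Suc n) 0" .
  have Bi0: "B $$ (Suc i, 0) = 0" if "i < n" for i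
    using arg_cong[OF colB, of "\<lambda>u. u $ Suc i"] B that by simp
  have B0i: "B $$ (0, Suc i) = 0" if "i < n" for i
    using hermB[of "Suc i" 0] Bi0[OF that] that by simp
  \<comment> \<open>So far the eigenvalue is only complex; its reality is read off from the diagonal
    of a Hermitian matrix.\<close>
  have "cnj (B $$ (0, 0)) = B $$ (0, 0)" by (rule hermB) simp_all
  then obtain l where l: "B $$ (0, 0) = complex_of_real l" by (metis Reals_cnj_iff Reals_cases)
  define B' where "B' = mat n n (\<lambda>(i, j). B $$ (Suc i, Suc j))"
  have B': "B' \<in> carrier_mat n n" by (simp add: B'_def)
  have "mat_adjoint B' = B'" by (rule eq_matI) (auto simp: B'_def hermB)
  then obtain U d where ud: "unitary_diagonalization n U d B'" using Suc.IH[OF B'] by blast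
  have "\<exists>V e. unitary_diagonalization (Suc n) V e B"
    by (rule unitary_diagonalization_block[OF B B' ud l B0i Bi0]) (simp_all add: B'_def)
  then show ?case
    using unitary_diagonalization_conjugate[OF H(1,2,3) A(1)] unfolding B_def by blast
qed

section \<open>From matrices to kernels\<close>

text \<open>Most significant bit first, in accordance with \<open>kron\<close>, where the first
  factor supplies the leading digit of an index.\<close>

fun bits_index :: "bool list \<Rightarrow> nat" where
  "bits_index [] = 0"
| "bits_index (b # xs) = of_bool b * 2 ^ length xs + bits_index xs"

lemma bits_index_less: "bits_index xs < 2 ^ length xs"
  by (induction xs) auto

lemma bits_index_append: "bits_index (xs @ ys) = bits_index xs * 2 ^ length ys + bits_index ys"
  by (induction xs) (simp_all add: power_add algebra_simps)

lemma bits_index_inj: "length xs = length ys \<Longrightarrow> bits_index xs = bits_index ys \<Longrightarrow> xs = ys"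
proof (induction xs ys rule: list_induct2)
  case (Cons b xs c ys)
  then have "b = c"
    using bits_index_less[of xs] bits_index_less[of ys] by (cases b; cases c) auto
  with Cons show ?case by simp
qed simp

lemma bij_bits_index: "bij_betw bits_index (words n) {..<2 ^ n}"
proof -
  have inj: "inj_on bits_index (words n)"
    by (rule inj_onI) (auto intro: bits_index_inj simp: words_def)
  have "bits_index ` words n \<subseteq> {..<2 ^ n}"
    using bits_index_less by (force simp: words_def)
  then have "bits_index ` words n = {..<2 ^ n}"
    by (intro card_subset_eq) (simp_all add: card_image[OF inj] card_words)
  with inj show ?thesis by (simp add: bij_betw_def)
qed

lemma bits_index_words: "x \<in> words n \<Longrightarrow> bits_index x < 2 ^ n"
  using bits_index_less[of x] by (simp add: words_def)

lemma sum_bits_index: "(\<Sum>i<2^n. g i) = (\<Sum>x\<in>words n. g (bits_index x))"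
  by (rule sum.reindex_bij_betw[OF bij_bits_index, symmetric])

lemma bits_index_eq_iff: "x \<in> words n \<Longrightarrow> y \<in> words n \<Longrightarrow> bits_index x = bits_index y \<longleftrightarrow> x = y"
  by (auto intro: bits_index_inj simp: words_def)

lemma bits_index_cases:
  assumes "i < 2 ^ n"
  obtains x where "x \<in> words n" "i = bits_index x"
  using assms bij_bits_index[of n] by (auto simp: bij_betw_def set_eq_iff image_iff)

section \<open>The difference operators on matrices and on kernels\<close>

definition mat_kernel :: "complex mat \<Rightarrow> kernel" where
  "mat_kernel A = (\<lambda>x y. A $$ (bits_index x, bits_index y))"

text \<open>The Kronecker product of the matrix unit (i, j) with any matrix lives on the block (i,
  j). Hence only the block containing (r, s) survives, and linearity reassembles \<Psi> of that
  block.\<close>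

lemma map_tensor_id_left:
  assumes rs: "r < a * b" "s < a * b"
    and \<Psi>: "\<And>Y. \<Psi> Y \<in> carrier_mat b b"
    and lin: "\<And>Y r s. r < b \<Longrightarrow> s < b \<Longrightarrow>
      \<Psi> Y $$ (r, s) = (\<Sum>i<b. \<Sum>j<b. Y $$ (i, j) * \<Psi> (matrix_unit b i j) $$ (r, s))"
  shows "map_tensor a b (\<lambda>X. X) \<Psi> X $$ (r, s) =
    \<Psi> (mat b b (\<lambda>(k, l). X $$ (r div b * b + k, s div b * b + l))) $$ (r mod b, s mod b)"
proof -
  have "b > 0" using rs by (cases b) auto
  then have dm: "r div b < a" "s div b < a" "r mod b < b" "s mod b < b"
    using rs by (auto simp: less_mult_imp_div_less)
  have dims: "dim_row (\<Psi> Y) = b" "dim_col (\<Psi> Y) = b" for Y using \<Psi>[of Y] by auto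
  have "map_tensor a b (\<lambda>X. X) \<Psi> X $$ (r, s) =
    (\<Sum>i<a. \<Sum>j<a. if j = s div b then (if i = r div b then
      (\<Sum>k<b. \<Sum>l<b. X $$ (i * b + k, j * b + l) * \<Psi> (matrix_unit b k l) $$ (r mod b, s mod b)) else 0) else 0)"
  proof -
    have "kron (matrix_unit a i j) (\<Psi> Y) $$ (r, s) =
      (if j = s div b then (if i = r div b then \<Psi> Y $$ (r mod b, s mod b) else 0) else 0)" for i j Y
      using rs dm by (auto simp: kron_def dims matrix_unit_def)
    then have "map_tensor a b (\<lambda>X. X) \<Psi> X $$ (r, s) =
      (\<Sum>i<a. \<Sum>j<a. \<Sum>k<b. \<Sum>l<b. X $$ (i * b + k, j * b + l) *
        (if j = s div b then (if i = r div b then \<Psi> (matrix_unit b k l) $$ (r mod b, s mod b) else 0) else 0))"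
      unfolding map_tensor_def using rs by simp
    also have "\<dots> = (\<Sum>i<a. \<Sum>j<a. if j = s div b then (if i = r div b then
      (\<Sum>k<b. \<Sum>l<b. X $$ (i * b + k, j * b + l) * \<Psi> (matrix_unit b k l) $$ (r mod b, s mod b)) else 0) else 0)"
      by (intro sum.cong refl) auto
    finally show ?thesis .
  qed
  also have "\<dots> = (\<Sum>k<b. \<Sum>l<b. X $$ (r div b * b + k, s div b * b + l) * \<Psi> (matrix_unit b k l) $$ (r mod b, s mod b))"
    using dm by simp
  also have "\<dots> = \<Psi> (mat b b (\<lambda>(k, l). X $$ (r div b * b + k, s div b * b + l))) $$ (r mod b, s mod b)"
    by (subst lin[OF dm(3,4), of "mat b b _"], intro sum.cong refl) simp
  finally show ?thesis .
qed

lemma map_tensor_qubit_diff: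
  assumes rs: "r < 2 * m" "s < 2 * m"
  shows "map_tensor 2 m qubit_diff (\<lambda>X. X) Y $$ (r, s) = Y $$ (r, s) -
    (if r div m = s div m then (Y $$ (r mod m, s mod m) + Y $$ (m + r mod m, m + s mod m)) / 2 else 0)"
proof -
  have "m > 0" using rs by (cases m) auto
  then have dm: "r div m < 2" "s div m < 2" "r mod m < m" "s mod m < m"
    using rs by (auto simp: less_mult_imp_div_less)
  have two: "(\<Sum>i<2. g i) = g 0 + g (1::nat)" for g :: "nat \<Rightarrow> complex" by (simp add: numeral_2_eq_2)
  have "map_tensor 2 m qubit_diff (\<lambda>X. X) Y $$ (r, s) =
    (\<Sum>i<2. \<Sum>j<2. \<Sum>k<m. \<Sum>l<m. if l = s mod m then (if k = r mod m then
      Y $$ (i * m + k, j * m + l) * qubit_diff (matrix_unit 2 i j) $$ (r div m, s div m) else 0) else 0)"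
  proof -
    have "kron (qubit_diff (matrix_unit 2 i j)) (matrix_unit m k l) $$ (r, s) =
      (if l = s mod m then (if k = r mod m then qubit_diff (matrix_unit 2 i j) $$ (r div m, s div m) else 0) else 0)" for i j k l
      using rs dm by (auto simp: kron_def matrix_unit_def qubit_diff_def)
    then have "map_tensor 2 m qubit_diff (\<lambda>X. X) Y $$ (r, s) =
      (\<Sum>i<2. \<Sum>j<2. \<Sum>k<m. \<Sum>l<m. Y $$ (i * m + k, j * m + l) *
        (if l = s mod m then (if k = r mod m then qubit_diff (matrix_unit 2 i j) $$ (r div m, s div m) else 0) else 0))"
      unfolding map_tensor_def using rs by simp
    then show ?thesis by (simp only: if_distrib[of "times _"] mult_zero_right)
  qed
  also have "\<dots> = (\<Sum>i<2. \<Sum>j<2. Y $$ (i * m + r mod m, j * m + s mod m) * qubit_diff (matrix_unit 2 i j) $$ (r div m, s div m))"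
    using dm by simp
  also have "\<dots> = Y $$ (r div m * m + r mod m, s div m * m + s mod m) -
    (if r div m = s div m then (Y $$ (r mod m, s mod m) + Y $$ (m + r mod m, m + s mod m)) / 2 else 0)"
  proof -
    have "r div m = 0 \<or> r div m = 1" "s div m = 0 \<or> s div m = 1" using dm by auto
    then show ?thesis
      unfolding two by (elim disjE) (simp_all add: qubit_diff_def matrix_unit_def mat_trace_def two field_simps)
  qed
  finally show ?thesis by simp
qed

lemma d_op_carrier:
  assumes "1 \<le> j" "j \<le> n"
  shows "d_op n j A \<in> carrier_mat (2^n) (2^n)"
proof -
  have "2 ^ n = (2::nat) ^ ((j - 1) + Suc (n - j))" using assms by simp
  then have "(2::nat) ^ (j - 1) * (2 * 2 ^ (n - j)) = 2 ^ n" by (simp only: power_add power_Suc)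
  then show ?thesis unfolding d_op_def by (metis map_tensor_carrier)
qed

text \<open>Indices split into prefix, bit j and suffix: the outer \<open>map_tensor\<close> selects
  the block given by the prefixes, the inner one compares the bits. \<open>d_op\<close> counts
  qubits from 1, hence \<open>Suc j\<close>.\<close>

lemma d_op_kdiff:
  assumes j: "j < n" and x: "x \<in> words n" and y: "y \<in> words n"
  shows "mat_kernel (d_op n (Suc j) A) x y = kdiff j (mat_kernel A) x y"
proof -
  define m :: nat where "m = 2 ^ (n - Suc j)"
  define xs b us where "xs = take j x" "b = x ! j" "us = drop (Suc j) x"
  note X = this
  define ys c vs where "ys = take j y" "c = y ! j" "vs = drop (Suc j) y"
  note Y = this
  have len: "length xs = j" "length ys = j" "length us = n - Suc j" "length vs = n - Suc j"
    and xy: "x = xs @ b # us" "y = ys @ c # vs"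
    using j x y by (auto simp: X Y words_def id_take_nth_drop)
  have lt: "bits_index us < m" "bits_index vs < m" "bits_index xs < 2 ^ j" "bits_index ys < 2 ^ j"
    using bits_index_less[of us] bits_index_less[of vs] bits_index_less[of xs] bits_index_less[of ys]
    by (simp_all add: len m_def)
  have ix: "bits_index (xs @ e # us) = bits_index xs * (2 * m) + (of_bool e * m + bits_index us)"
    and iy: "bits_index (ys @ e # vs) = bits_index ys * (2 * m) + (of_bool e * m + bits_index vs)" for e
    by (simp_all add: bits_index_append len m_def)
  have lt2: "of_bool e * m + k < 2 * m" if "k < m" for e k using that by (cases e) auto
  have dm: "(q * (2 * m) + (of_bool e * m + k)) div (2 * m) = q" "(q * (2 * m) + (of_bool e * m + k)) mod (2 * m) = of_bool e * m + k"
     "(of_bool e * m + k) div m = of_bool e" "(of_bool e * m + k) mod m = k" if "k < m" for q e k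
    using lt2[OF that, of e] that by (simp_all add: div_mod_tensor)
  have size: "bits_index x < 2 ^ j * (2 * m)" "bits_index y < 2 ^ j * (2 * m)"
  proof -
    have "2 ^ n = (2::nat) ^ (j + Suc (n - Suc j))" using j by simp
    then have "2 ^ j * (2 * m) = 2 ^ n" by (simp only: power_add power_Suc m_def)
    then show "bits_index x < 2 ^ j * (2 * m)" "bits_index y < 2 ^ j * (2 * m)"
      using bits_index_words[OF x] bits_index_words[OF y] by simp_all
  qed
  define Z where "Z = mat (2 * m) (2 * m) (\<lambda>(k, l). A $$ (bits_index xs * (2 * m) + k, bits_index ys * (2 * m) + l))"
  have "d_op n (Suc j) A $$ (bits_index x, bits_index y) =
    map_tensor 2 m qubit_diff (\<lambda>X. X) Z $$ (of_bool b * m + bits_index us, of_bool c * m + bits_index vs)"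
  proof -
    have "d_op n (Suc j) A $$ (bits_index x, bits_index y) =
      map_tensor (2 ^ j) (2 * m) (\<lambda>X. X) (map_tensor 2 m qubit_diff (\<lambda>X. X)) A $$ (bits_index x, bits_index y)"
      by (simp add: d_op_def m_def)
    also have "\<dots> = map_tensor 2 m qubit_diff (\<lambda>X. X)
       (mat (2 * m) (2 * m) (\<lambda>(k, l). A $$ (bits_index x div (2 * m) * (2 * m) + k, bits_index y div (2 * m) * (2 * m) + l)))
       $$ (bits_index x mod (2 * m), bits_index y mod (2 * m))"
      by (rule map_tensor_id_left[OF size map_tensor_carrier map_tensor_linear])
    finally show ?thesis unfolding xy ix iy dm[OF lt(1)] dm[OF lt(2)] Z_def .
  qed
  also have "\<dots> = Z $$ (of_bool b * m + bits_index us, of_bool c * m + bits_index vs) -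
    (if b = c then (Z $$ (bits_index us, bits_index vs) + Z $$ (m + bits_index us, m + bits_index vs)) / 2 else 0)"
    using map_tensor_qubit_diff[OF lt2[OF lt(1), of b] lt2[OF lt(2), of c], of Z] dm(3,4)[OF lt(1)] dm(3,4)[OF lt(2)]
    by simp
  also have "\<dots> = kdiff j (mat_kernel A) x y"
    unfolding xy kdiff_append[OF len(1,2)] mat_kernel_def ix iy
    using lt2[OF lt(1), of b] lt2[OF lt(2), of c] lt by (simp add: Z_def)
  finally show ?thesis by (simp add: mat_kernel_def)
qed

text \<open>One and the same U diagonalizes A^* A, |A| and |A|^p, and \<open>mat_fun_eq\<close>
  allows all of them to be computed with it.\<close>

lemma schatten_norm_powr:
  assumes A: "A \<in> carrier_mat (2^n) (2^n)" and p: "p > 0"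
    and ud: "unitary_diagonalization (2^n) U d A"
  shows "schatten_norm n p A powr p = (\<Sum>i<2^n. \<bar>d i\<bar> powr p) / 2 ^ n"
proof -
  let ?N = "2 ^ n :: nat"
  let ?D = "\<lambda>g. mat_diag ?N (\<lambda>i. complex_of_real (g i))"
  define Us where "Us = mat_adjoint U"
  have U: "U \<in> carrier_mat ?N ?N" "Us \<in> carrier_mat ?N ?N" "Us * U = 1\<^sub>m ?N" "A = U * ?D d * Us"
    using ud by (auto simp: unitary_diagonalization_def Us_def mat_adjoint_carrier)
  note ass = assoc_mult_mat[of _ ?N ?N _ ?N _ ?N]
  note mc = mult_carrier_mat[of _ ?N ?N _ ?N]
  have ud': "unitary_diagonalization ?N U g (U * ?D g * Us)" for g
    using U by (simp add: unitary_diagonalization_def Us_def)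
  have calculus: "mat_fun f (U * ?D g * Us) = U * ?D (\<lambda>i. f (g i)) * Us" for f g
    using mat_fun_eq[OF ud'[of g], of f] by (simp add: Us_def)
  have adjD: "mat_adjoint (?D g) = ?D g" for g
    by (rule eq_matI) (auto simp: mat_diag_def)
  have adjUs: "mat_adjoint Us = U"
    by (rule eq_matI) (use U(1) in \<open>auto simp: Us_def\<close>)
  have dimD: "dim_row (?D g) = ?N" "dim_col (?D g) = ?N" for g by (simp_all add: mat_diag_def)
  have "mat_adjoint A = U * (?D d * Us)"
    unfolding U(4) using U(1,2) by (simp add: mat_adjoint_mult dimD adjD adjUs Us_def[symmetric])
  then have "mat_adjoint A * A = U * ?D d * (Us * U) * ?D d * Us"
    unfolding U(4) using U(1,2) by (simp add: ass mc)
  also have "\<dots> = U * (?D d * ?D d) * Us"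
    unfolding U(3) using U(1,2) by (simp add: ass mc right_mult_one_mat[of _ ?N ?N] del: mat_diag_diag)
  also have "?D d * ?D d = ?D (\<lambda>i. (d i)\<^sup>2)" by (simp add: power2_eq_square)
  finally have "mat_abs A = U * ?D (\<lambda>i. \<bar>d i\<bar>) * Us"
    unfolding mat_abs_def by (simp only: calculus real_sqrt_abs)
  then have "mat_fun (\<lambda>x. x powr p) (mat_abs A) = U * ?D (\<lambda>i. \<bar>d i\<bar> powr p) * Us"
    by (simp add: calculus)
  moreover have "mat_trace (U * ?D g * Us) = complex_of_real (\<Sum>i<2^n. g i)" for g
  proof -
    let ?B = "U * ?D g * Us"
    have B: "?B \<in> carrier_mat ?N ?N" using U(1,2) by (simp add: mc)
    note iff = unitary_diagonalization_iff[OF B U(1), of g]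
    have "mat_trace ?B = (\<Sum>i<?N. \<Sum>k<?N. complex_of_real (g k) * U $$ (i, k) * cnj (U $$ (i, k)))"
      unfolding mat_trace_def using B iff ud'[of g] by (intro sum.cong) auto
    also have "\<dots> = (\<Sum>k<?N. \<Sum>i<?N. complex_of_real (g k) * U $$ (i, k) * cnj (U $$ (i, k)))" by (rule sum.swap)
    also have "\<dots> = (\<Sum>k<?N. complex_of_real (g k) * (\<Sum>i<?N. cnj (U $$ (i, k)) * U $$ (i, k)))"
      by (simp add: sum_distrib_left mult_ac)
    also have "\<dots> = (\<Sum>k<?N. complex_of_real (g k))"
      using iff ud'[of g] by (intro sum.cong) auto
    finally show ?thesis by simp
  qed
  ultimately have "schatten_norm n p A = ((\<Sum>i<2^n. \<bar>d i\<bar> powr p) / 2 ^ n) powr (1 / p)"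
    by (simp add: schatten_norm_def)
  then show ?thesis using p by (simp add: powr_powr sum_nonneg)
qed

text \<open>The basis consists of the columns of U. The kernel f is compared with A on
  \<open>words n\<close> only, since that is where \<open>d_op_kdiff\<close> identifies
  \<open>kdiff\<close> with \<open>d_op\<close>.\<close>

lemma eigenbasis_of_unitary_diagonalization:
  assumes A: "A \<in> carrier_mat (2^n) (2^n)" and ud: "unitary_diagonalization (2^n) U d A"
    and f: "\<And>x y. x \<in> words n \<Longrightarrow> y \<in> words n \<Longrightarrow> f x y = mat_kernel A x y"
  shows "eigenbasis n f (\<lambda>i x. U $$ (bits_index x, i)) d"
proof -
  let ?N = "2 ^ n :: nat"
  define u where "u = (\<lambda>i x. U $$ (bits_index x, i))"
  have U: "U \<in> carrier_mat ?N ?N" using ud by (simp add: unitary_diagonalization_def)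
  have orth: "(\<Sum>x\<in>words n. cnj (u i x) * u j x) = (if i = j then 1 else 0)" if "i < ?N" "j < ?N" for i j
    using ud that unfolding unitary_diagonalization_iff[OF A U] u_def by (simp add: sum_bits_index)
  have F: "f x y = (\<Sum>i<?N. complex_of_real (d i) * u i x * cnj (u i y))" if "x \<in> words n" "y \<in> words n" for x y
    using ud bits_index_words[OF that(1)] bits_index_words[OF that(2)]
    unfolding unitary_diagonalization_iff[OF A U] u_def f[OF that] mat_kernel_def by blast
  \<comment> \<open>For square matrices a left inverse is a right inverse: orthonormal columns
    become a completeness relation.\<close>
  have UU: "U * mat_adjoint U = 1\<^sub>m ?N"
    using ud mat_mult_left_right_inverse[OF mat_adjoint_carrier[OF U] U] by (simp add: unitary_diagonalization_def)
  have comp: "(\<Sum>i<?N. U $$ (r, i) * cnj (U $$ (s, i))) = (if r = s then 1 else 0)" if "r < ?N" "s < ?N" for r s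
    using arg_cong[OF UU, of "\<lambda>X. X $$ (r, s)"] U that
    by (simp add: scalar_prod_def lessThan_atLeast0)
  have complete: "(\<Sum>i<?N. u i x * cnj (u i y)) = (if x = y then 1 else 0)" if "x \<in> words n" "y \<in> words n" for x y
    unfolding u_def using that by (simp add: comp bits_index_words bits_index_eq_iff)
  have unit: "vnorm2 n (u i) = 1" if "i < ?N" for i
  proof -
    have "complex_of_real (vnorm2 n (u i)) = 1"
      unfolding vnorm2_def using orth[OF that that] by (simp add: cnj_mult_self)
    then show ?thesis by (simp only: of_real_eq_1_iff)
  qed
  have "qform n f (u i) = complex_of_real (d i)" if i: "i < ?N" for i
  proof -
    have "kapply n f (u i) x = complex_of_real (d i) * u i x" if x: "x \<in> words n" for x
    proof -
      have "kapply n f (u i) x = (\<Sum>y\<in>words n. \<Sum>k<?N. complex_of_real (d k) * u k x * (cnj (u k y) * u i y))"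
        unfolding kapply_def by (intro sum.cong refl) (simp add: F x sum_distrib_left sum_distrib_right mult_ac)
      also have "\<dots> = (\<Sum>k<?N. complex_of_real (d k) * u k x * (\<Sum>y\<in>words n. cnj (u k y) * u i y))"
        unfolding sum_distrib_left by (rule sum.swap)
      also have "\<dots> = (\<Sum>k<?N. if k = i then complex_of_real (d k) * u k x else 0)"
        by (intro sum.cong refl) (simp add: orth i)
      also have "\<dots> = complex_of_real (d i) * u i x" using i by simp
      finally show ?thesis .
    qed
    then have "qform n f (u i) = complex_of_real (d i) * (\<Sum>x\<in>words n. cnj (u i x) * u i x)"
      by (simp add: qform_def sum_distrib_left mult_ac)
    then show ?thesis by (simp add: orth i)
  qed
  then show ?thesis
    unfolding eigenbasis_def u_def[symmetric] using complete unit F by auto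
qed

text \<open>Both directions serve: A is turned into a Hermitian kernel, and Hermiticity of d_j A is
  obtained for its kernel and carried back to the matrix.\<close>

lemma herm_mat_kernel:
  assumes "A \<in> carrier_mat (2^n) (2^n)"
  shows "herm n (mat_kernel A) \<longleftrightarrow> mat_adjoint A = A"
proof
  assume "mat_adjoint A = A"
  then have "cnj (A $$ (r, s)) = A $$ (s, r)" if "r < 2 ^ n" "s < 2 ^ n" for r s
    using index_mat_adjoint[of s A r] assms that by simp
  then show "herm n (mat_kernel A)" by (intro hermI) (simp add: mat_kernel_def bits_index_words)
next
  assume h: "herm n (mat_kernel A)"
  show "mat_adjoint A = A"
  proof (rule eq_matI)
    fix r s assume "r < dim_row A" "s < dim_col A"
    then have "r < 2 ^ n" "s < 2 ^ n" using assms by auto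
    then obtain x y where xy: "x \<in> words n" "y \<in> words n" "r = bits_index x" "s = bits_index y"
      by (metis bits_index_cases)
    then show "mat_adjoint A $$ (r, s) = A $$ (r, s)"
      using hermD[OF h xy(2,1)] assms bits_index_words by (simp add: mat_kernel_def)
  qed (use assms in auto)
qed

lemma herm_cong:
  "(\<And>x y. x \<in> words n \<Longrightarrow> y \<in> words n \<Longrightarrow> f x y = g x y) \<Longrightarrow> herm n f \<longleftrightarrow> herm n g"
  by (simp add: herm_def)

theorem theorem3p9:
  fixes p :: real
  assumes "1 \<le> p" and "p < 2"
  shows "\<exists>C::real. C > 0 \<and>
    (\<forall>n::nat. n \<ge> 1 \<longrightarrow>
      (\<forall>A::complex mat. quantum_boolean n A \<and> balanced A \<longrightarrow>
        (MAX j\<in>{1..n}. influence n p j A) \<ge> C * (ln (real n) / real n)))"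
proof -
  define \<delta> where "\<delta> = min (1/4) ((2 - p) / (2 * p))"
  have "\<delta> > 0" using assms by (simp add: \<delta>_def)
  then obtain C where C: "C > 0" "\<And>n M. n \<ge> 1 \<Longrightarrow> 1 \<le> 2 * real n * M \<Longrightarrow>
      (M \<le> 1 \<Longrightarrow> 16 powr (- (2 * real n * M)) \<le> 6 * real n * M powr (1 + \<delta>)) \<Longrightarrow>
      C * (ln (real n) / real n) \<le> M"
    using log_lower_bound by metis
  have "C * (ln (real n) / real n) \<le> (MAX j\<in>{1..n}. influence n p j A)"
    if n: "n \<ge> 1" and A: "quantum_boolean n A" "balanced A" for n A
  proof -
    define f where "f = mat_kernel A"
    define M where "M = (MAX j\<in>{1..n}. influence n p j A)"
    have cA: "A \<in> carrier_mat (2^n) (2^n)" "mat_adjoint A = A" "A * A = 1\<^sub>m (2^n)"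
      using A(1) by (simp_all add: quantum_boolean_def)
    have f: "herm n f" unfolding f_def using herm_mat_kernel[OF cA(1)] cA(2) by simp
    have sq: "kmult n f f x y = (if x = y then 1 else 0)" if xy: "x \<in> words n" "y \<in> words n" for x y
    proof -
      have "kmult n f f x y = (A * A) $$ (bits_index x, bits_index y)"
        using cA(1) bits_index_words[OF xy(1)] bits_index_words[OF xy(2)]
        by (simp add: kmult_def f_def mat_kernel_def scalar_prod_def sum_bits_index atLeast0LessThan)
      also have "\<dots> = (if x = y then 1 else 0)"
        unfolding cA(3) using xy by (simp add: bits_index_words bits_index_eq_iff)
      finally show ?thesis .
    qed
    have tr: "(\<Sum>x\<in>words n. f x x) = 0"
      using A(2) cA(1) by (simp add: balanced_def mat_trace_def f_def mat_kernel_def sum_bits_index)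
    have "\<exists>u d. eigenbasis n (kdiff j f) u d \<and> influence n p (Suc j) A = (\<Sum>i<2^n. \<bar>d i\<bar> powr p) / 2 ^ n"
      if j: "j < n" for j
    proof -
      define B where "B = d_op n (Suc j) A"
      have B: "B \<in> carrier_mat (2^n) (2^n)" unfolding B_def using j by (intro d_op_carrier) auto
      have ker: "kdiff j f x y = mat_kernel B x y" if "x \<in> words n" "y \<in> words n" for x y
        unfolding B_def f_def by (rule d_op_kdiff[OF j that, symmetric])
      have "herm n (mat_kernel B)" using herm_kdiff[OF f j] herm_cong[OF ker] by simp
      then obtain U d where ud: "unitary_diagonalization (2^n) U d B"
        using hermitian_unitary_diagonalization[OF B] herm_mat_kernel[OF B] by blast
      show ?thesis
        using eigenbasis_of_unitary_diagonalization[OF B ud ker] schatten_norm_powr[OF B _ ud, of p] assms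
        by (auto simp: influence_def B_def)
    qed
    then obtain u d where ud: "\<And>j. j < n \<Longrightarrow> eigenbasis n (kdiff j f) (u j) (d j)"
      and infl: "\<And>j. j < n \<Longrightarrow> influence n p (Suc j) A = (\<Sum>i<2^n. \<bar>d j i\<bar> powr p) / 2 ^ n"
      by metis
    have M: "(\<Sum>i<2^n. \<bar>d j i\<bar> powr p) / 2 ^ n \<le> M" if "j < n" for j
      unfolding infl[OF that, symmetric] M_def using that by (intro Max_ge) auto
    show ?thesis
      unfolding M_def[symmetric]
      by (rule C(2)[OF n])
        (use boolean_kernel_bound[OF assms f sq tr ud M] in \<open>simp_all add: \<delta>_def\<close>)
  qed
  then show ?thesis using C(1) by blast
qed

end
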